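(* Let $\alpha\in(0,1)$, let $H\in C(\mathbb{T}^N\times\mathbb{R}^N)$ be coercive, i.e. $\lim_{|p|\to+\infty}\inf_{x\in\mathbb{T}^N}H(x,p)=+\infty$, and let $g:\mathbb{T}^N\to\mathbb{R}$ be Lipschitz continuous. Assume that at least one of the following two conditions holds: (A) there is $c_H>0$ such that $|H(x,p)-H(y,p)|\le c_H(1+|p|)|x-y|$ for all $x,y\in\mathbb{T}^N$, $p\in\mathbb{R}^N$; (B) there are $m>1$, $A>0$, $c_H>1$ such that for all $\mu\in(0,1)$, $x,y\in\mathbb{T}^N$, $p\in\mathbb{R}^N$, $$\mu H(x,\mu^{-1}p)-H(x,p)\ge(1-\mu)\big(c_H^{-1}|p|^m-A\big),\qquad |H(x,p)-H(y,p)|\le c_H(1+|p|^m)|x-y|.$$ Let $u:\mathbb{T}^N\times[0,+\infty)\to\mathbb{R}$ be a bounded, continuous viscosity solution of $$\partial_t^\alpha u+H(x,Du)=0\ \text{ in }\mathbb{T}^N\times(0,+\infty),\qquad u(\cdot,0)=g\ \text{ in }\mathbb{T}^N .$$ Then there exists a constant $L>1$, depending only on the data ($\alpha,N,H,g$) and on $\|u\|_\infty$, such that $$|u(x,s)-u(x,t)|\le L|s-t|^\alpha\qquad\text{for all }x\in\mathbb{T}^N,\ s,t\ge0 .$$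
   Context: $\mathbb{T}^N=\mathbb{R}^N/\mathbb{Z}^N$ is the flat torus, $|x-y|$ for $x,y\in\mathbb{T}^N$ is the periodic (quotient) distance. $Du$ denotes the gradient in $x$. Caputo derivative of order $\alpha\in(0,1)$ (normalizing constant taken equal to 1): a function $\phi$ on $[0,+\infty)$ is extended to $s<0$ by $\phi(s)=\phi(0)$ and, when the integral exists, $$\partial_t^\alpha\phi(t)=\int_{-\infty}^t\frac{\phi(t)-\phi(s)}{|t-s|^{1+\alpha}}\,ds,\qquad t>0.$$ For $a<b\le t$ set $\partial_t^\alpha[a]\phi(t)=\int_{-\infty}^a\frac{\phi(t)-\phi(s)}{|t-s|^{1+\alpha}}ds$ and $\partial_t^\alpha[a,b]\phi(t)=\int_a^b\frac{\phi(t)-\phi(s)}{|t-s|^{1+\alpha}}ds$. Viscosity solutions: let $u$ be continuous on $\mathbb{T}^N\times[0,+\infty)$, extended by $u(x,s)=u(x,0)$ for $s<0$. $u$ is a viscosity subsolution (resp. supersolution) of $\partial_t^\alpha u+H(x,Du)=0$ in $\mathbb{T}^N\times(0,+\infty)$ if for every $(x_0,t_0)$ with $t_0>0$, every $\delta\in(0,t_0)$ and every $C^1$ function $\varphi$ such that $u-\varphi$ has a maximum (resp. minimum) at $(x_0,t_0)$ over $B_\delta(x_0)\times[t_0-\delta,t_0+\delta]$, one has $$\partial_t^\alpha[t_0-\delta]u(x_0,\cdot)(t_0)+\partial_t^\alpha[t_0-\delta,t_0]\varphi(x_0,\cdot)(t_0)+H(x_0,D\varphi(x_0,t_0))\le0\quad(\text{resp.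 }\ge0).$$ A viscosity solution is both a sub- and a supersolution. The initial condition is understood pointwise. *)

theory Defs
  imports "HOL-Analysis.Analysis"
begin

text \<open>
  Functions on the flat torus are represented by their lifts, that is, by functions on
  \<open>real ^ 'n\<close> that are periodic with respect to the integer lattice; here \<open>N = CARD('n)\<close>.
\<close>

definition int_lattice :: "(real ^ 'n) set" where
  "int_lattice = {k. \<forall>i. k $ i \<in> \<int>}"

definition torus_periodic :: "(real ^ 'n \<Rightarrow> 'b) \<Rightarrow> bool" where
  "torus_periodic f \<longleftrightarrow> (\<forall>x. \<forall>k\<in>int_lattice. f (x + k) = f x)"

definition torus_dist :: "real ^ 'n \<Rightarrow> real ^ 'n \<Rightarrow> real" where
  "torus_dist x y = (INF k\<in>int_lattice. norm (x - y + k))"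

definition torus_lipschitz :: "(real ^ 'n \<Rightarrow> real) \<Rightarrow> bool" where
  "torus_lipschitz g \<longleftrightarrow> torus_periodic g \<and> (\<exists>C. \<forall>x y. \<bar>g x - g y\<bar> \<le> C * torus_dist x y)"

definition extend_past :: "(real \<Rightarrow> real) \<Rightarrow> real \<Rightarrow> real" where
  "extend_past \<phi> s = (if s < 0 then \<phi> 0 else \<phi> s)"

definition caputo_tail :: "real \<Rightarrow> real \<Rightarrow> (real \<Rightarrow> real) \<Rightarrow> real \<Rightarrow> real" where
  "caputo_tail \<alpha> a \<phi> t =
     (LBINT s:{..a}. (extend_past \<phi> t - extend_past \<phi> s) / \<bar>t - s\<bar> powr (1 + \<alpha>))"

definition caputo_between :: "real \<Rightarrow> real \<Rightarrow> real \<Rightarrow> (real \<Rightarrow> real) \<Rightarrow> real \<Rightarrow> real" where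
  "caputo_between \<alpha> a b \<phi> t = (LBINT s:{a..b}. (\<phi> t - \<phi> s) / \<bar>t - s\<bar> powr (1 + \<alpha>))"

definition C1_on :: "('a::real_normed_vector) set \<Rightarrow> ('a \<Rightarrow> real) \<Rightarrow> bool" where
  "C1_on U f \<longleftrightarrow>
     (\<exists>f' :: 'a \<Rightarrow> 'a \<Rightarrow>\<^sub>L real.
        (\<forall>z\<in>U. (f has_derivative blinfun_apply (f' z)) (at z)) \<and> continuous_on U f')"

text \<open>
  A test function is only ever evaluated at positive times, because \<open>\<delta> < t\<^sub>0\<close> below.
\<close>

definition test_function :: "(real ^ 'n \<Rightarrow> real \<Rightarrow> real) \<Rightarrow> bool" where
  "test_function \<phi> \<longleftrightarrow>
     (\<forall>t>0. torus_periodic (\<lambda>x. \<phi> x t)) \<and> C1_on (UNIV \<times> {0<..}) (\<lambda>(x, t). \<phi> x t)"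

definition gradient :: "('a::real_inner \<Rightarrow> real) \<Rightarrow> 'a \<Rightarrow> 'a" where
  "gradient f x = (THE p. GDERIV f x :> p)"

definition cylinder :: "real ^ 'n \<Rightarrow> real \<Rightarrow> real \<Rightarrow> ((real ^ 'n) \<times> real) set" where
  "cylinder x\<^sub>0 t\<^sub>0 \<delta> = {x. torus_dist x x\<^sub>0 < \<delta>} \<times> {t\<^sub>0 - \<delta>..t\<^sub>0 + \<delta>}"

definition viscosity_operator ::
  "real \<Rightarrow> (real ^ 'n \<Rightarrow> real ^ 'n \<Rightarrow> real) \<Rightarrow> (real ^ 'n \<Rightarrow> real \<Rightarrow> real)
     \<Rightarrow> (real ^ 'n \<Rightarrow> real \<Rightarrow> real) \<Rightarrow> real ^ 'n \<Rightarrow> real \<Rightarrow> real \<Rightarrow> real" where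
  "viscosity_operator \<alpha> H u \<phi> x\<^sub>0 t\<^sub>0 \<delta> =
     caputo_tail \<alpha> (t\<^sub>0 - \<delta>) (u x\<^sub>0) t\<^sub>0 + caputo_between \<alpha> (t\<^sub>0 - \<delta>) t\<^sub>0 (\<phi> x\<^sub>0) t\<^sub>0
       + H x\<^sub>0 (gradient (\<lambda>x. \<phi> x t\<^sub>0) x\<^sub>0)"

definition viscosity_subsolution ::
  "real \<Rightarrow> (real ^ 'n \<Rightarrow> real ^ 'n \<Rightarrow> real) \<Rightarrow> (real ^ 'n \<Rightarrow> real \<Rightarrow> real) \<Rightarrow> bool" where
  "viscosity_subsolution \<alpha> H u \<longleftrightarrow>
     (\<forall>x\<^sub>0. \<forall>t\<^sub>0>0. \<forall>\<delta>\<in>{0<..<t\<^sub>0}. \<forall>\<phi>.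
        test_function \<phi> \<and>
        (\<forall>(x, t)\<in>cylinder x\<^sub>0 t\<^sub>0 \<delta>. u x t - \<phi> x t \<le> u x\<^sub>0 t\<^sub>0 - \<phi> x\<^sub>0 t\<^sub>0) \<longrightarrow>
        viscosity_operator \<alpha> H u \<phi> x\<^sub>0 t\<^sub>0 \<delta> \<le> 0)"

definition viscosity_supersolution ::
  "real \<Rightarrow> (real ^ 'n \<Rightarrow> real ^ 'n \<Rightarrow> real) \<Rightarrow> (real ^ 'n \<Rightarrow> real \<Rightarrow> real) \<Rightarrow> bool" where
  "viscosity_supersolution \<alpha> H u \<longleftrightarrow>
     (\<forall>x\<^sub>0. \<forall>t\<^sub>0>0. \<forall>\<delta>\<in>{0<..<t\<^sub>0}. \<forall>\<phi>.
        test_function \<phi> \<and>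
        (\<forall>(x, t)\<in>cylinder x\<^sub>0 t\<^sub>0 \<delta>. u x t - \<phi> x t \<ge> u x\<^sub>0 t\<^sub>0 - \<phi> x\<^sub>0 t\<^sub>0) \<longrightarrow>
        viscosity_operator \<alpha> H u \<phi> x\<^sub>0 t\<^sub>0 \<delta> \<ge> 0)"

definition bounded_viscosity_solution ::
  "real \<Rightarrow> (real ^ 'n \<Rightarrow> real ^ 'n \<Rightarrow> real) \<Rightarrow> (real ^ 'n \<Rightarrow> real)
     \<Rightarrow> (real ^ 'n \<Rightarrow> real \<Rightarrow> real) \<Rightarrow> bool" where
  "bounded_viscosity_solution \<alpha> H g u \<longleftrightarrow>
     (\<forall>t\<ge>0. torus_periodic (\<lambda>x. u x t)) \<and>
     continuous_on (UNIV \<times> {0..}) (\<lambda>(x, t). u x t) \<and>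
     bounded ((\<lambda>(x, t). u x t) ` (UNIV \<times> {0..})) \<and>
     viscosity_subsolution \<alpha> H u \<and> viscosity_supersolution \<alpha> H u \<and>
     (\<forall>x. u x 0 = g x)"

definition spacetime_sup_norm :: "(real ^ 'n \<Rightarrow> real \<Rightarrow> real) \<Rightarrow> real" where
  "spacetime_sup_norm u = (SUP (x, t)\<in>UNIV \<times> {0..}. \<bar>u x t\<bar>)"

definition torus_hamiltonian :: "(real ^ 'n \<Rightarrow> real ^ 'n \<Rightarrow> real) \<Rightarrow> bool" where
  "torus_hamiltonian H \<longleftrightarrow>
     (\<forall>p. torus_periodic (\<lambda>x. H x p)) \<and> continuous_on UNIV (\<lambda>(x, p). H x p)"

definition coercive :: "(real ^ 'n \<Rightarrow> real ^ 'n \<Rightarrow> real) \<Rightarrow> bool" where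
  "coercive H \<longleftrightarrow> filterlim (\<lambda>p. INF x. H x p) at_top at_infinity"

definition condition_A :: "(real ^ 'n \<Rightarrow> real ^ 'n \<Rightarrow> real) \<Rightarrow> bool" where
  "condition_A H \<longleftrightarrow>
     (\<exists>c>0. \<forall>x y p. \<bar>H x p - H y p\<bar> \<le> c * (1 + norm p) * torus_dist x y)"

definition condition_B :: "(real ^ 'n \<Rightarrow> real ^ 'n \<Rightarrow> real) \<Rightarrow> bool" where
  "condition_B H \<longleftrightarrow>
     (\<exists>m>1. \<exists>A>0. \<exists>c>1. \<forall>\<mu>\<in>{0<..<1}. \<forall>x y p.
        \<mu> * H x (inverse \<mu> *\<^sub>R p) - H x p \<ge> (1 - \<mu>) * (inverse c * norm p powr m - A) \<and>
        \<bar>H x p - H y p\<bar> \<le> c * (1 + norm p powr m) * torus_dist x y)"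

end

theory Submission
  imports Defs
begin

text \<open>
  Since \<open>C * t powr \<alpha>\<close> has Caputo derivative at least \<open>C / \<alpha>\<close>, the functions
  \<open>g y \<plusminus> (K * sqrt (\<epsilon>\<^sup>2 + sinsq (x - y)) + C * t powr \<alpha>)\<close> are strict barriers for large \<open>C\<close>; here
  \<open>sinsq\<close> is a smooth periodic substitute for the squared distance. They give
  \<open>\<bar>u x t - g x\<bar> \<le> C * t powr \<alpha>\<close>.

  Extended to negative times, \<open>u\<close> and its translate by \<open>h\<close> in time therefore differ by at most
  \<open>C * \<bar>h\<bar> powr \<alpha>\<close> as long as one of the two is still at the initial datum. Doubling the
  variables propagates this bound to all times: comparing the maximum point with its backward
  translates, both times being shifted by the same amount, controls the whole memory term, and the
  penalty \<open>\<beta> * \<tau> powr \<alpha>\<close> both makes the maximum attained and contributes the strictly positive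
  amount \<open>\<beta> / \<alpha>\<close>.
\<close>

section \<open>A smooth periodic squared distance\<close>

lemma torus_representative:
  fixes x :: "real ^ 'n"
  obtains k where "k \<in> int_lattice" and "x + k \<in> cbox 0 1"
proof
  show "(\<chi> i. - of_int \<lfloor>x $ i\<rfloor>) \<in> int_lattice"
    by (simp add: int_lattice_def)
  show "x + (\<chi> i. - of_int \<lfloor>x $ i\<rfloor>) \<in> cbox 0 1"
    by (simp add: mem_box_cart algebra_simps) linarith
qed

lemma torus_periodic_representative:
  fixes f :: "real ^ 'n \<Rightarrow> 'b"
  assumes "torus_periodic f"
  obtains x' where "x' \<in> cbox 0 1" and "f x' = f x"
proof -
  obtain k where "k \<in> int_lattice" "x + k \<in> cbox 0 1" by (rule torus_representative)
  then show ?thesis using assms that[of "x + k"] by (simp add: torus_periodic_def)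
qed

text \<open>The squared torus distance is not differentiable where the nearest lattice translate
  changes, so it cannot enter a test function. This smooth sum vanishes exactly on the lattice, and
  its square root dominates the distance.\<close>

definition sinsq :: "real ^ 'n \<Rightarrow> real" where
  "sinsq z = (\<Sum>i\<in>UNIV. (sin (pi * z $ i))\<^sup>2)"

definition sinsq_gradient :: "real ^ 'n \<Rightarrow> real ^ 'n" where
  "sinsq_gradient z = (\<chi> i. 2 * pi * sin (pi * z $ i) * cos (pi * z $ i))"

lemma sinsq_nonneg: "0 \<le> sinsq z"
  by (simp add: sinsq_def sum_nonneg)

lemma sinsq_0: "sinsq 0 = 0"
  by (simp add: sinsq_def)

lemma continuous_on_sinsq [continuous_intros]:
  fixes f :: "'a::t2_space \<Rightarrow> real ^ 'n"
  assumes "continuous_on S f"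
  shows "continuous_on S (\<lambda>x. sinsq (f x))"
  unfolding sinsq_def using assms
  by (intro continuous_intros continuous_on_sin continuous_on_mult_left continuous_on_component)

lemma continuous_on_sinsq_gradient [continuous_intros]:
  fixes f :: "'a::t2_space \<Rightarrow> real ^ 'n"
  assumes "continuous_on S f"
  shows "continuous_on S (\<lambda>x. sinsq_gradient (f x))"
  unfolding sinsq_gradient_def using assms
  by (intro continuous_intros continuous_on_sin continuous_on_cos continuous_on_mult_left
      continuous_on_component)

text \<open>The shift multiplies the sine by \<open>cos (pi * k)\<close>, whose square is 1.\<close>

lemma sin_sq_add_int:
  fixes k :: real
  assumes "k \<in> \<int>"
  shows "(sin (pi * (z + k)))\<^sup>2 = (sin (pi * z))\<^sup>2"
proof -
  have "sin (pi * k) = 0" using assms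
    by (metis mult.commute sin_npi_int Ints_cases)
  moreover from this have "(cos (pi * k))\<^sup>2 = 1"
    by (simp add: cos_squared_eq)
  ultimately show ?thesis
    by (simp add: distrib_left sin_add power_mult_distrib)
qed

lemma torus_periodic_sinsq: "torus_periodic sinsq"
  by (auto simp: torus_periodic_def sinsq_def int_lattice_def sin_sq_add_int)

lemma GDERIV_sinsq: "GDERIV sinsq z :> sinsq_gradient z"
proof -
  have "((\<lambda>z. (sin (pi * z $ i))\<^sup>2) has_derivative
      (\<lambda>h. h $ i * (2 * pi * sin (pi * z $ i) * cos (pi * z $ i)))) (at z)" for i
    by (auto intro!: derivative_eq_intros bounded_linear.has_derivative[OF bounded_linear_vec_nth]
        simp: algebra_simps)
  then show ?thesis
    unfolding gderiv_def sinsq_def[abs_def] sinsq_gradient_def inner_vec_def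
    by (auto intro!: has_derivative_sum)
qed

text \<open>Each cosine factor is at most 1 in modulus. The bound gives the barrier a slope
  independent of its regularisation, and in the doubling argument it makes gradient times distance
  comparable to the penalty itself.\<close>

lemma norm_sinsq_gradient: "norm (sinsq_gradient z) \<le> 2 * pi * sqrt (sinsq z)"
proof -
  have "(norm (sinsq_gradient z))\<^sup>2 = (\<Sum>i\<in>UNIV. (2 * pi * sin (pi * z $ i) * cos (pi * z $ i))\<^sup>2)"
    by (simp add: sinsq_gradient_def norm_vec_def L2_set_def sum_nonneg)
  also have "\<dots> \<le> (\<Sum>i\<in>UNIV. (2 * pi)\<^sup>2 * (sin (pi * z $ i))\<^sup>2)"
    unfolding power_mult_distrib
    by (intro sum_mono mult_left_le) (auto simp: abs_square_le_1)
  also have "\<dots> = (2 * pi * sqrt (sinsq z))\<^sup>2"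
    by (simp add: sinsq_def power_mult_distrib sum_distrib_left sum_nonneg)
  finally show ?thesis
    by (rule power2_le_imp_le) (simp add: sinsq_nonneg)
qed

text \<open>Up to 1/6 the difference \<open>sin (pi * v) - v\<close> increases, its derivative being
  at least \<open>pi / 2 - 1\<close>; from 1/6 to 1/2 the sine is already at least 1/2.\<close>

lemma abs_le_abs_sin_pi:
  fixes w :: real
  assumes "\<bar>w\<bar> \<le> 1 / 2"
  shows "\<bar>w\<bar> \<le> \<bar>sin (pi * w)\<bar>"
proof -
  have *: "v \<le> sin (pi * v)" if "0 \<le> v" "v \<le> 1 / 2" for v :: real
  proof (cases "v \<le> 1 / 6")
      case True
      have "sin (pi * 0) - 0 \<le> sin (pi * v) - v"
      proof (rule DERIV_nonneg_imp_nondecreasing[OF that(1)])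
        fix x assume x: "0 \<le> x" "x \<le> v"
        have "cos (pi / 3) \<le> cos (pi * x)"
          using x True by (intro cos_monotone_0_pi_le) auto
        then have "1 \<le> pi * cos (pi * x)"
          using pi_ge_two mult_mono[of 2 pi "1 / 2" "cos (pi * x)"] by (simp add: cos_60)
        moreover have "((\<lambda>v. sin (pi * v) - v) has_real_derivative pi * cos (pi * x) - 1) (at x)"
          by (auto intro!: derivative_eq_intros)
        ultimately show "\<exists>d. ((\<lambda>v. sin (pi * v) - v) has_real_derivative d) (at x) \<and> 0 \<le> d"
          by force
      qed
      then show ?thesis by simp
    next
      case False
      have "sin (pi / 6) \<le> sin (pi * v)"
        using False that by (intro sin_monotone_2pi_le) auto
      then show ?thesis using that by (simp add: sin_30)
    qed
  show ?thesis
    using *[of "\<bar>w\<bar>"] assms by (cases "w \<ge> 0") auto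
qed

lemma bdd_below_torus_norms: "bdd_below ((\<lambda>k. norm (x - y + k)) ` int_lattice)"
  by (rule bdd_belowI[of _ 0]) auto

lemma int_lattice_0: "0 \<in> int_lattice"
  by (simp add: int_lattice_def)

lemma torus_dist_nonneg: "0 \<le> torus_dist x y"
  unfolding torus_dist_def using int_lattice_0 by (intro cINF_greatest) auto

text \<open>Rounding every coordinate of \<open>x - y\<close> selects a lattice translate with
  coordinates of modulus at most 1/2. There the sine dominates coordinate by coordinate, and the
  sine terms do not see the translation.\<close>

lemma torus_dist_le_sqrt_sinsq:
  fixes x y :: "real ^ 'n"
  shows "torus_dist x y \<le> sqrt (sinsq (x - y))"
proof -
  define k :: "real ^ 'n" where "k = (\<chi> i. - of_int (round ((x - y) $ i)))"
  have k: "k \<in> int_lattice" by (simp add: k_def int_lattice_def)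
  have "((x - y + k) $ i)\<^sup>2 \<le> (sin (pi * (x - y) $ i))\<^sup>2" for i
  proof -
    have "\<bar>(x - y + k) $ i\<bar> \<le> 1 / 2"
      using of_int_round_abs_le[of "(x - y) $ i"] by (simp add: k_def abs_minus_commute)
    then have "((x - y + k) $ i)\<^sup>2 \<le> (sin (pi * ((x - y + k) $ i)))\<^sup>2"
      using abs_le_abs_sin_pi by (simp add: abs_le_square_iff)
    also have "\<dots> = (sin (pi * (x - y) $ i))\<^sup>2"
      using k by (simp add: sin_sq_add_int int_lattice_def)
    finally show ?thesis .
  qed
  then have "norm (x - y + k) \<le> sqrt (sinsq (x - y))"
    unfolding norm_vec_def L2_set_def sinsq_def by (auto intro!: sum_mono)
  moreover have "torus_dist x y \<le> norm (x - y + k)"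
    unfolding torus_dist_def by (rule cINF_lower[OF bdd_below_torus_norms k])
  ultimately show ?thesis by simp
qed

section \<open>Gradients and separated test functions\<close>

lemma gradient_eqI:
  assumes "GDERIV f x :> p"
  shows "gradient f x = p"
  unfolding gradient_def
proof (rule the_equality)
  show "GDERIV f x :> p" by fact
  fix q assume "GDERIV f x :> q"
  then have "(\<lambda>h. h \<bullet> q) = (\<lambda>h. h \<bullet> p)"
    using assms has_derivative_unique unfolding gderiv_def by blast
  then show "q = p"
    by (metis inner_commute vector_eq_rdot)
qed

text \<open>Every test function below splits into a space part and a time part. The joint derivative
  is the inner product with the pair of partial derivatives, which is continuous as a bounded linear
  functional.\<close>

lemma test_function_separated:
  fixes a :: "real ^ 'n \<Rightarrow> real" and b :: "real \<Rightarrow> real"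
  assumes "torus_periodic a" and a: "\<And>x. GDERIV a x :> a' x" and "continuous_on UNIV a'"
    and b: "\<And>t. t > 0 \<Longrightarrow> (b has_real_derivative b' t) (at t)" and "continuous_on {0<..} b'"
  shows "test_function (\<lambda>x t. a x + b t)"
  unfolding test_function_def C1_on_def
proof (intro conjI allI impI exI ballI)
  show "torus_periodic (\<lambda>x. a x + b t)" for t
    using assms(1) by (simp add: torus_periodic_def)
  let ?f' = "\<lambda>z. blinfun_inner_left (a' (fst z), b' (snd z))"
  show "continuous_on (UNIV \<times> {0<..}) ?f'"
    using assms(3,5)
    by (intro bounded_linear.continuous_on[OF bounded_linear_blinfun_inner_left] continuous_on_Pair
        continuous_on_compose2[OF assms(3)] continuous_on_compose2[OF assms(5)] continuous_intros) auto
  fix z :: "(real ^ 'n) \<times> real" assume z: "z \<in> UNIV \<times> {0<..}"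
  have 1: "((\<lambda>z. a (fst z)) has_derivative (\<lambda>h. fst h \<bullet> a' (fst z))) (at z)"
    using has_derivative_compose[OF _ a[unfolded gderiv_def], of fst fst z UNIV] has_derivative_fst[OF has_derivative_ident]
    by auto
  have "(b has_derivative (*) (b' (snd z))) (at (snd z))"
    using b[of "snd z"] z by (auto simp: has_field_derivative_def)
  then have 2: "((\<lambda>z. b (snd z)) has_derivative (\<lambda>h. b' (snd z) * snd h)) (at z)"
    using has_derivative_compose[OF has_derivative_snd[OF has_derivative_ident]] by blast
  show "((\<lambda>(x, t). a x + b t) has_derivative blinfun_apply (?f' z)) (at z)"
    using has_derivative_add[OF 1 2]
    by (simp add: case_prod_unfold inner_prod_def blinfun_inner_left.rep_eq[abs_def] mult.commute)
qed

section \<open>Caputo integrals and touching test functions\<close>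

text \<open>For a nonnegative Borel function the gauge integral is also a Lebesgue integral. This
  carries the explicit integrals of powers over to the integral used in
  \<open>caputo_tail\<close>.\<close>

lemma set_integral_lborel_of_has_integral:
  fixes f :: "real \<Rightarrow> real"
  assumes "f \<in> borel_measurable borel" and "S \<in> sets borel"
    and "\<And>x. x \<in> S \<Longrightarrow> 0 \<le> f x" and I: "(f has_integral I) S"
  shows "set_integrable lborel S f" and "(LBINT x:S. f x) = I"
proof -
  let ?f = "\<lambda>x. indicator S x *\<^sub>R f x"
  have "(?f has_integral I) UNIV"
    using I has_integral_restrict_UNIV[of S f I]
    by (simp add: indicator_def of_bool_def if_distrib[of "\<lambda>c. c * _"] cong: if_cong)
  moreover have "?f \<in> borel_measurable borel" using assms(1,2) by measurable
  moreover have "0 \<le> ?f x" for x using assms(3) by (auto simp: indicator_def)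
  ultimately have "integral\<^sup>N lborel ?f = I" and "0 \<le> I"
    using nn_integral_has_integral_lborel has_integral_nonneg by blast+
  then have "has_bochner_integral lborel ?f I"
    using \<open>?f \<in> borel_measurable borel\<close> \<open>\<And>x. 0 \<le> ?f x\<close>
    by (intro has_bochner_integral_nn_integral) auto
  then show "set_integrable lborel S f" and "(LBINT x:S. f x) = I"
    by (auto simp: set_integrable_def set_lebesgue_integral_def has_bochner_integral_iff)
qed

text \<open>With \<open>d = t\<close> this is the exact mass that turns an increment
  \<open>c * t powr \<alpha>\<close>, persisting for all delays beyond \<open>t\<close>, into the
  contribution \<open>c / \<alpha>\<close>.\<close>

lemma
  fixes \<alpha> d :: real
  assumes "0 < \<alpha>" and "0 < d"
  shows set_integrable_caputo_kernel: "set_integrable lborel {d..} (\<lambda>r. 1 / r powr (1 + \<alpha>))"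
    and set_integral_caputo_kernel: "(LBINT r:{d..}. 1 / r powr (1 + \<alpha>)) = d powr (- \<alpha>) / \<alpha>"
proof -
  have "((\<lambda>r. 1 / r powr (1 + \<alpha>)) has_integral (d powr (- \<alpha>) / \<alpha>)) {d..}"
    using has_integral_powr_to_inf[of "- (1 + \<alpha>)" d] assms
    unfolding powr_minus_divide[of _ "1 + \<alpha>"] by (simp add: powr_minus_divide)
  note set_integral_lborel_of_has_integral[OF _ _ _ this]
  then show "set_integrable lborel {d..} (\<lambda>r. 1 / r powr (1 + \<alpha>))"
    and "(LBINT r:{d..}. 1 / r powr (1 + \<alpha>)) = d powr (- \<alpha>) / \<alpha>" by auto
qed

text \<open>Substituting \<open>s = t - r\<close> indexes the memory by the delay \<open>r\<close>,
  so that tails taken at two different times can be subtracted under one integral.\<close>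

lemma caputo_tail_shift:
  assumes "0 < d"
  shows "caputo_tail \<alpha> (t - d) \<phi> t =
    (LBINT r:{d..}. (extend_past \<phi> t - extend_past \<phi> (t - r)) * (1 / r powr (1 + \<alpha>)))"
  unfolding caputo_tail_def set_lebesgue_integral_def using assms
  by (subst lborel_integral_real_affine[where c="-1" and t=t])
     (auto intro!: Bochner_Integration.integral_cong split: split_indicator)

lemma extend_past_eq: "extend_past \<phi> t = \<phi> (max t 0)"
  by (auto simp: extend_past_def max_def)

lemma caputo_tail_uminus: "caputo_tail \<alpha> a (\<lambda>t. - \<phi> t) t = - caputo_tail \<alpha> a \<phi> t"
proof -
  have neg: "(- a - - b) / c = - ((a - b) / c)" for a b c :: real
    by (simp add: minus_divide_left)
  show ?thesis
    unfolding caputo_tail_def extend_past_eq neg set_lebesgue_integral_def scaleR_minus_right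
      Bochner_Integration.integral_minus ..
qed

lemma continuous_on_extend_past:
  assumes "continuous_on {0..} \<phi>"
  shows "continuous_on UNIV (extend_past \<phi>)"
  unfolding extend_past_eq[abs_def]
  by (intro continuous_on_compose2[OF assms] continuous_intros) auto

lemma set_integrable_caputo_tail:
  assumes "0 < \<alpha>" and "0 < d" and \<phi>: "continuous_on {0..} \<phi>" and bnd: "\<And>t. 0 \<le> t \<Longrightarrow> \<bar>\<phi> t\<bar> \<le> M"
  shows "set_integrable lborel {d..}
    (\<lambda>r. (extend_past \<phi> t - extend_past \<phi> (t - r)) * (1 / r powr (1 + \<alpha>)))"
proof (rule set_integrable_bound)
  show "set_integrable lborel {d..} (\<lambda>r. (2 * M) * (1 / r powr (1 + \<alpha>)))"
    using set_integrable_caputo_kernel[OF assms(1,2)] by (rule set_integrable_mult_right)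
  have "extend_past \<phi> \<in> borel_measurable borel"
    by (rule borel_measurable_continuous_onI[OF continuous_on_extend_past[OF \<phi>]])
  then show "set_borel_measurable lborel {d..}
      (\<lambda>r. (extend_past \<phi> t - extend_past \<phi> (t - r)) * (1 / r powr (1 + \<alpha>)))"
    unfolding set_borel_measurable_def by measurable
  have "\<bar>extend_past \<phi> t - extend_past \<phi> s\<bar> \<le> 2 * M" for s
    using bnd[of "max t 0"] bnd[of "max s 0"] by (simp add: extend_past_eq)
  then have "norm ((extend_past \<phi> t - extend_past \<phi> s) * (1 / r powr (1 + \<alpha>)))
      \<le> norm ((2 * M) * (1 / r powr (1 + \<alpha>)))" for r s
    unfolding norm_mult by (intro mult_right_mono) (force intro: order_trans)+
  then show "AE r in lborel. r \<in> {d..} \<longrightarrow>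
      norm ((extend_past \<phi> t - extend_past \<phi> (t - r)) * (1 / r powr (1 + \<alpha>)))
      \<le> norm ((2 * M) * (1 / r powr (1 + \<alpha>)))"
    by simp
qed

text \<open>The assumed lower bound on the increments is nonnegative for every delay and equals
  \<open>c * t powr \<alpha>\<close> once \<open>r \<ge> t\<close>. Keeping only those delays and
  integrating against the kernel gives \<open>c / \<alpha>\<close>, whatever \<open>t\<close> and
  \<open>d\<close> are.\<close>

lemma caputo_tail_difference_ge:
  assumes "0 < \<alpha>" and d: "0 < d" "d < t" and "0 \<le> c"
    and f: "continuous_on {0..} f" "\<And>t. 0 \<le> t \<Longrightarrow> \<bar>f t\<bar> \<le> M"
    and g: "continuous_on {0..} g" "\<And>t. 0 \<le> t \<Longrightarrow> \<bar>g t\<bar> \<le> M"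
    and incr: "\<And>r. 0 < r \<Longrightarrow> c * (t powr \<alpha> - (max (t - r) 0) powr \<alpha>)
      \<le> \<mu> * (extend_past f t - extend_past f (t - r)) - (extend_past g s - extend_past g (s - r))"
  shows "c / \<alpha> \<le> \<mu> * caputo_tail \<alpha> (t - d) f t - caputo_tail \<alpha> (s - d) g s"
proof -
  let ?k = "\<lambda>r. 1 / r powr (1 + \<alpha>)"
  let ?f = "\<lambda>r. (extend_past f t - extend_past f (t - r)) * ?k r"
  let ?g = "\<lambda>r. (extend_past g s - extend_past g (s - r)) * ?k r"
  have intf: "set_integrable lborel {d..} ?f" and intg: "set_integrable lborel {d..} ?g"
    using set_integrable_caputo_tail[OF assms(1) d(1)] f g by blast+
  have "c / \<alpha> = c * t powr \<alpha> * (LBINT r:{t..}. ?k r)"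
    using assms(1) d by (simp add: set_integral_caputo_kernel powr_minus)
  also have "\<dots> = (LBINT r:{t..}. c * t powr \<alpha> * ?k r)"
    by (rule set_integral_mult_right[symmetric])
  also have "\<dots> = (LBINT r. indicator {d..} r *\<^sub>R (indicator {t..} r * (c * t powr \<alpha> * ?k r)))"
    unfolding set_lebesgue_integral_def using d
    by (intro Bochner_Integration.integral_cong) (auto split: split_indicator)
  also have "\<dots> \<le> (LBINT r:{d..}. \<mu> * ?f r - ?g r)"
    unfolding set_lebesgue_integral_def
  proof (rule integral_mono)
    have "set_integrable lborel {t..} (\<lambda>r. c * t powr \<alpha> * ?k r)"
      using assms(1) d by (intro set_integrable_mult_right set_integrable_caputo_kernel) auto
    then show "integrable lborel (\<lambda>r. indicator {d..} r *\<^sub>R (indicator {t..} r * (c * t powr \<alpha> * ?k r)))"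
      unfolding set_integrable_def using d
      by (elim Bochner_Integration.integrable_cong[THEN iffD1, rotated -1]) (auto split: split_indicator)
    show "integrable lborel (\<lambda>r. indicator {d..} r *\<^sub>R (\<mu> * ?f r - ?g r))"
      using set_integral_diff(1)[OF set_integrable_mult_right[OF intf] intg]
      unfolding set_integrable_def .
    fix r :: real
    have "indicator {t..} r * (c * t powr \<alpha>) * ?k r \<le> (\<mu> * (extend_past f t - extend_past f (t - r))
        - (extend_past g s - extend_past g (s - r))) * ?k r" if "d \<le> r"
    proof (rule mult_right_mono)
      have "indicator {t..} r * (c * t powr \<alpha>) \<le> c * (t powr \<alpha> - (max (t - r) 0) powr \<alpha>)"
        using assms(1,4) d that by (auto split: split_indicator intro!: mult_nonneg_nonneg powr_mono2)
      also have "\<dots> \<le> \<mu> * (extend_past f t - extend_past f (t - r))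
        - (extend_past g s - extend_past g (s - r))"
        using incr d that by simp
      finally show "indicator {t..} r * (c * t powr \<alpha>) \<le> \<dots>" .
    qed auto
    then show "indicator {d..} r *\<^sub>R (indicator {t..} r * (c * t powr \<alpha> * ?k r))
        \<le> indicator {d..} r *\<^sub>R (\<mu> * ?f r - ?g r)"
      by (auto split: split_indicator simp: algebra_simps diff_divide_distrib add_divide_distrib)
  qed
  also have "\<dots> = \<mu> * (LBINT r:{d..}. ?f r) - (LBINT r:{d..}. ?g r)"
    unfolding set_integral_diff(2)[OF set_integrable_mult_right[OF intf, of \<mu>] intg]
      set_integral_mult_right ..
  finally show ?thesis by (simp add: caputo_tail_shift[OF d(1)])
qed

text \<open>The Lipschitz bound cancels one power of the singularity and leaves
  \<open>K * r powr (- \<alpha>)\<close>, integrable at 0 because \<open>\<alpha> < 1\<close>. The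
  bound tends to 0 with \<open>d\<close>.\<close>

lemma caputo_between_bound:
  assumes "0 < \<alpha>" and "\<alpha> < 1" and d: "0 < d"
    and lip: "\<And>s. t - d \<le> s \<Longrightarrow> s \<le> t \<Longrightarrow> \<bar>\<phi> t - \<phi> s\<bar> \<le> K * (t - s)"
  shows "\<bar>caputo_between \<alpha> (t - d) t \<phi> t\<bar> \<le> K * d powr (1 - \<alpha>) / (1 - \<alpha>)"
proof -
  let ?F = "\<lambda>r. indicator {0..d} r *\<^sub>R ((\<phi> t - \<phi> (t - r)) / \<bar>r\<bar> powr (1 + \<alpha>))"
  let ?G = "\<lambda>r. indicator {0..d} r *\<^sub>R (K * r powr (- \<alpha>))"
  have eq: "caputo_between \<alpha> (t - d) t \<phi> t = (LBINT r. ?F r)"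
    unfolding caputo_between_def set_lebesgue_integral_def
    by (subst lborel_integral_real_affine[where c="-1" and t=t])
       (auto intro!: Bochner_Integration.integral_cong split: split_indicator)
  have "0 \<le> K" using lip[of "t - d"] d by (smt (verit) zero_le_mult_iff)
  have "((\<lambda>r. r powr (- \<alpha>)) has_integral (d powr (1 - \<alpha>) / (1 - \<alpha>))) {0..d}"
    using has_integral_powr_from_0[of "- \<alpha>" d] assms by (simp add: add.commute)
  note * = set_integral_lborel_of_has_integral[OF _ _ _ this]
  have intG: "integrable lborel ?G"
    using set_integrable_mult_right[OF *(1), of K] by (simp add: set_integrable_def)
  have G: "(LBINT r. ?G r) = K * d powr (1 - \<alpha>) / (1 - \<alpha>)"
    using set_integral_mult_right[of lborel "{0..d}" K "\<lambda>r. r powr (- \<alpha>)"]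
    unfolding set_lebesgue_integral_def[symmetric] by (simp add: *(2))
  \<comment> \<open>At \<open>r = 0\<close> both sides vanish, since division by zero and powers of
    zero both give 0.\<close>
  have le: "\<bar>?F r\<bar> \<le> ?G r" for r
  proof (cases "0 < r \<and> r \<le> d")
    case True
    then have "\<bar>\<phi> t - \<phi> (t - r)\<bar> / r powr (1 + \<alpha>) \<le> (K * r) / r powr (1 + \<alpha>)"
      using lip[of "t - r"] by (intro divide_right_mono) auto
    also have "\<dots> = K * r powr (- \<alpha>)"
      using True by (simp add: powr_add powr_minus field_simps)
    finally show ?thesis using True by (simp add: abs_div)
  qed (use \<open>0 \<le> K\<close> in \<open>auto split: split_indicator\<close>)
  show ?thesis
  proof (cases "integrable lborel ?F")
    case True
    then have "\<bar>LBINT r. ?F r\<bar> \<le> (LBINT r. ?G r)"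
      using Bochner_Integration.integral_norm_bound_integral[OF True intG] le by simp
    then show ?thesis using eq G by simp
  next
    \<comment> \<open>No measurability of \<open>\<phi>\<close> is assumed; a non-integrable
      integrand has integral 0 by convention, and the bound is nonnegative.\<close>
    case False
    then show ?thesis using eq \<open>0 \<le> K\<close> assms by (simp add: not_integrable_integral_eq)
  qed
qed

section \<open>Touching by separated test functions, and reflection of solutions\<close>

text \<open>The derivative is bounded on the compact interval from \<open>t / 2\<close> to
  \<open>t\<close>. The interval stays away from 0, where a function such as
  \<open>t powr \<alpha>\<close> has unbounded slope.\<close>

lemma C1_lipschitz_from_left:
  fixes b :: "real \<Rightarrow> real"
  assumes b: "\<And>t. t > 0 \<Longrightarrow> (b has_real_derivative b' t) (at t)" and cont: "continuous_on {0<..} b'"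
    and "0 < t"
  obtains K where "\<And>s. t / 2 \<le> s \<Longrightarrow> s \<le> t \<Longrightarrow> \<bar>b t - b s\<bar> \<le> K * (t - s)"
proof -
  have "compact (b' ` {t / 2..t})"
    using assms(3) by (intro compact_continuous_image continuous_on_subset[OF cont]) auto
  then obtain K where K: "\<And>x. x \<in> {t / 2..t} \<Longrightarrow> norm (b' x) \<le> K"
    using compact_imp_bounded bounded_iff by (metis imageI)
  have "norm (b t - b s) \<le> K * norm (t - s)" if "t / 2 \<le> s" "s \<le> t" for s
    using that K assms(3)
    by (intro field_differentiable_bound[of "{t / 2..t}" b b'])
       (auto intro!: DERIV_subset[OF b])
  then show ?thesis using that by auto
qed

text \<open>As \<open>d\<close> tends to 0 the part of the operator carried by the test function
  disappears into \<open>e\<close>, leaving the memory of \<open>u\<close> itself. Validity for all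
  small \<open>d\<close> allows the inequalities at two different points to be used with a common
  \<open>d\<close>.\<close>

lemma viscosity_subsolution_touching:
  fixes a :: "real ^ 'n \<Rightarrow> real" and b :: "real \<Rightarrow> real"
  assumes "0 < \<alpha>" and "\<alpha> < 1" and sub: "viscosity_subsolution \<alpha> H u"
    and a: "torus_periodic a" "\<And>x. GDERIV a x :> a' x" "continuous_on UNIV a'"
    and b: "\<And>t. t > 0 \<Longrightarrow> (b has_real_derivative b' t) (at t)" "continuous_on {0<..} b'"
    and t0: "0 < t0"
    and max: "\<And>x t. 0 < t \<Longrightarrow> u x t - a x - b t \<le> u x0 t0 - a x0 - b t0"
    and e: "0 < e"
  obtains d0 where "0 < d0"
    and "\<And>d. 0 < d \<Longrightarrow> d < d0 \<Longrightarrow> caputo_tail \<alpha> (t0 - d) (u x0) t0 + H x0 (a' x0) \<le> e"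
proof -
  obtain K where K: "\<And>s. t0 / 2 \<le> s \<Longrightarrow> s \<le> t0 \<Longrightarrow> \<bar>b t0 - b s\<bar> \<le> K * (t0 - s)"
    using C1_lipschitz_from_left[OF b t0] by metis
  have "((\<lambda>d. K * d powr (1 - \<alpha>) / (1 - \<alpha>)) \<longlongrightarrow> K * 0 powr (1 - \<alpha>) / (1 - \<alpha>)) (at_right 0)"
    using assms(1,2) by (intro tendsto_intros) (auto simp: eventually_at_right_less eventually_at_filter)
  then have "\<forall>\<^sub>F d in at_right 0. K * d powr (1 - \<alpha>) / (1 - \<alpha>) < e"
    using e by (intro order_tendstoD(2)) auto
  then obtain d1 where d1: "0 < d1" "\<And>d. 0 < d \<Longrightarrow> d < d1 \<Longrightarrow> K * d powr (1 - \<alpha>) / (1 - \<alpha>) < e"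
    by (auto simp: eventually_at_right_field)
  show ?thesis
  \<comment> \<open>The bound \<open>t0 / 2\<close> keeps the cylinder at positive times and within
    the range of the Lipschitz constant \<open>K\<close>.\<close>
  proof (rule that[of "min d1 (t0 / 2)"])
    show "0 < min d1 (t0 / 2)" using d1 t0 by simp
    fix d assume d: "0 < d" "d < min d1 (t0 / 2)"
    let ?\<phi> = "\<lambda>x t. a x + b t"
    have "test_function ?\<phi>" by (rule test_function_separated[OF a b])
    moreover have "\<forall>(x, t)\<in>cylinder x0 t0 d. u x t - ?\<phi> x t \<le> u x0 t0 - ?\<phi> x0 t0"
      using max d by (force simp: cylinder_def algebra_simps)
    ultimately have "viscosity_operator \<alpha> H u ?\<phi> x0 t0 d \<le> 0"
      using sub t0 d unfolding viscosity_subsolution_def by auto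
    moreover have "gradient (\<lambda>x. ?\<phi> x t0) x0 = a' x0"
      using GDERIV_add[OF a(2) GDERIV_const] by (intro gradient_eqI) simp
    moreover have "\<bar>caputo_between \<alpha> (t0 - d) t0 (?\<phi> x0) t0\<bar> \<le> K * d powr (1 - \<alpha>) / (1 - \<alpha>)"
      using d K by (intro caputo_between_bound assms(1,2)) auto
    ultimately show "caputo_tail \<alpha> (t0 - d) (u x0) t0 + H x0 (a' x0) \<le> e"
      using d1(2)[of d] d by (simp add: viscosity_operator_def)
  qed
qed

text \<open>Since \<open>gradient\<close> is a definite description, its sign can be moved only once
  a gradient is known to exist. It is obtained by restricting the joint derivative to
  \<open>(h, 0)\<close> and representing that functional through its adjoint.\<close>

lemma gradient_test_function_uminus:
  assumes "test_function \<phi>" and "0 < t"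
  shows "gradient (\<lambda>x. - \<phi> x t) x = - gradient (\<lambda>x. \<phi> x t) x"
proof -
  obtain f' where "((\<lambda>(x, t). \<phi> x t) has_derivative blinfun_apply f') (at (x, t))"
    using assms unfolding test_function_def C1_on_def by auto
  moreover have "((\<lambda>x. (x, t)) has_derivative (\<lambda>h. (h, 0))) (at x)"
    by (auto intro!: derivative_eq_intros)
  ultimately have D: "((\<lambda>x. \<phi> x t) has_derivative (\<lambda>h. blinfun_apply f' (h, 0))) (at x)"
    using has_derivative_compose[of "\<lambda>x. (x, t)" "\<lambda>h. (h, 0)" x UNIV "\<lambda>(x, t). \<phi> x t"] by simp
  define q where "q = adjoint (\<lambda>h. blinfun_apply f' (h, 0)) 1"
  have "blinfun_apply f' (h, 0) = h \<bullet> q" for h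
    unfolding q_def using adjoint_works[OF has_derivative_linear[OF D], of h 1] by simp
  then have "GDERIV (\<lambda>x. \<phi> x t) x :> q"
    using D by (simp add: gderiv_def)
  from gradient_eqI[OF this] gradient_eqI[OF GDERIV_minus[OF this]] show ?thesis by simp
qed

text \<open>Negating the test function exchanges minima and maxima; the Caputo terms are odd and the
  gradient changes sign. Every supersolution estimate thereby becomes a subsolution
  estimate.\<close>

lemma viscosity_supersolution_uminus:
  fixes u :: "real ^ 'n \<Rightarrow> real \<Rightarrow> real"
  assumes super: "viscosity_supersolution \<alpha> H u"
  shows "viscosity_subsolution \<alpha> (\<lambda>x p. - H x (- p)) (\<lambda>x t. - u x t)"
  unfolding viscosity_subsolution_def
proof (intro allI impI ballI, elim conjE)
  fix x0 :: "real ^ 'n" and t0 d :: real and \<phi>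
  assume t0: "0 < t0" and d: "d \<in> {0<..<t0}" and test: "test_function \<phi>"
    and max: "\<forall>(x, t)\<in>cylinder x0 t0 d. - u x t - \<phi> x t \<le> - u x0 t0 - \<phi> x0 t0"
  have "test_function (\<lambda>x t. - \<phi> x t)"
    unfolding test_function_def C1_on_def
  proof (intro conjI allI impI)
    show "torus_periodic (\<lambda>x. - \<phi> x t)" if "0 < t" for t
      using test that by (simp add: test_function_def torus_periodic_def)
    obtain f' where f': "\<And>z. z \<in> UNIV \<times> {0<..} \<Longrightarrow>
        ((\<lambda>(x, t). \<phi> x t) has_derivative blinfun_apply (f' z)) (at z)"
      and "continuous_on (UNIV \<times> {0<..}) f'"
      using test unfolding test_function_def C1_on_def by blast
    then have "continuous_on (UNIV \<times> {0<..}) (\<lambda>z. - f' z)"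
      by (intro continuous_intros)
    moreover have "((\<lambda>(x, t). - \<phi> x t) has_derivative blinfun_apply (- f' z)) (at z)"
      if "z \<in> UNIV \<times> {0<..}" for z
      using has_derivative_minus[OF f'[OF that]]
      by (simp add: case_prod_unfold blinfun.minus_left[abs_def])
    ultimately show "\<exists>f'. (\<forall>z\<in>UNIV \<times> {0<..}.
        ((\<lambda>(x, t). - \<phi> x t) has_derivative blinfun_apply (f' z)) (at z)) \<and>
        continuous_on (UNIV \<times> {0<..}) f'" by (intro exI[of _ "\<lambda>z. - f' z"]) simp
  qed
  moreover have "\<forall>(x, t)\<in>cylinder x0 t0 d. u x t - - \<phi> x t \<ge> u x0 t0 - - \<phi> x0 t0"
  proof clarify
    fix x t assume "(x, t) \<in> cylinder x0 t0 d"
    then have "- u x t - \<phi> x t \<le> - u x0 t0 - \<phi> x0 t0" using max by blast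
    then show "u x0 t0 - - \<phi> x0 t0 \<le> u x t - - \<phi> x t" by simp
  qed
  ultimately have "0 \<le> viscosity_operator \<alpha> H u (\<lambda>x t. - \<phi> x t) x0 t0 d"
    using super t0 d unfolding viscosity_supersolution_def by auto
  also have "\<dots> = - viscosity_operator \<alpha> (\<lambda>x p. - H x (- p)) (\<lambda>x t. - u x t) \<phi> x0 t0 d"
  proof -
    have neg: "(- a - - b) / c = - ((a - b) / c)" for a b c :: real
      by (simp add: minus_divide_left)
    \<comment> \<open>The sign leaves the integral without any integrability, the default value 0
      being its own negative.\<close>
    have "caputo_between \<alpha> (t0 - d) t0 (\<lambda>t. - \<phi> x0 t) t0 = - caputo_between \<alpha> (t0 - d) t0 (\<phi> x0) t0"
      unfolding caputo_between_def neg set_lebesgue_integral_def scaleR_minus_right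
        Bochner_Integration.integral_minus ..
    then show ?thesis
      by (simp add: viscosity_operator_def caputo_tail_uminus gradient_test_function_uminus[OF test t0])
  qed
  finally show "viscosity_operator \<alpha> (\<lambda>x p. - H x (- p)) (\<lambda>x t. - u x t) \<phi> x0 t0 d \<le> 0" by simp
qed

section \<open>Barriers and doubling of variables\<close>

text \<open>The point \<open>z0\<close> fixes a level. Points above it only need a competitor in the
  compact set, which periodicity and growth will provide.\<close>

lemma attains_global_max:
  fixes f :: "'a::topological_space \<Rightarrow> real"
  assumes "compact K" and cont: "continuous_on UNIV f"
    and red: "\<And>z. f z \<le> f z0 \<or> (\<exists>z'\<in>K. f z \<le> f z')"
  obtains z where "\<And>z'. f z' \<le> f z"
proof -
  have "compact (insert z0 K)" using assms(1) by (simp add: compact_insert)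
  then obtain z where z: "z \<in> insert z0 K" "\<forall>z'\<in>insert z0 K. f z' \<le> f z"
    using continuous_attains_sup[of "insert z0 K" f] continuous_on_subset[OF cont] by auto
  show ?thesis
  proof (rule that)
    show "f z' \<le> f z" for z' using red[of z'] z(2) order_trans by blast
  qed
qed

text \<open>A fraction in the unit interval is at most its own power \<open>\<alpha>\<close>;
  applied to \<open>x / (x + y)\<close> and \<open>y / (x + y)\<close> and summed, this is
  subadditivity.\<close>

lemma powr_add_le:
  fixes x y :: real
  assumes "0 \<le> x" and "0 \<le> y" and "0 < \<alpha>" and "\<alpha> < 1"
  shows "(x + y) powr \<alpha> \<le> x powr \<alpha> + y powr \<alpha>"
proof (cases "x + y = 0")
  case False
  then have pos: "0 < x + y" using assms by simp
  have le: "w / (x + y) * (x + y) powr \<alpha> \<le> w powr \<alpha>" if "0 \<le> w" "w \<le> x + y" for w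
  proof -
    have "w / (x + y) \<le> (w / (x + y)) powr \<alpha>"
      using that pos assms powr_mono'[of \<alpha> 1 "w / (x + y)"] by simp
    then have "w / (x + y) * (x + y) powr \<alpha> \<le> (w / (x + y)) powr \<alpha> * (x + y) powr \<alpha>"
      by (intro mult_right_mono) auto
    also have "\<dots> = w powr \<alpha>"
      using that pos by (simp add: powr_divide)
    finally show ?thesis .
  qed
  have "(x + y) powr \<alpha> = x / (x + y) * (x + y) powr \<alpha> + y / (x + y) * (x + y) powr \<alpha>"
    using False by (simp flip: distrib_right add_divide_distrib)
  also have "\<dots> \<le> x powr \<alpha> + y powr \<alpha>"
    using le assms by (intro add_mono) auto
  finally show ?thesis .
qed (use assms in auto)

lemma continuous_on_pos_part_powr:
  assumes "0 < (\<alpha>::real)" and "continuous_on S f"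
  shows "continuous_on S (\<lambda>z. (max (f z) 0) powr \<alpha>)"
  using assms by (intro continuous_on_powr' continuous_intros) auto

lemma GDERIV_sinsq_shift: "GDERIV (\<lambda>x. sinsq (x - y)) x :> sinsq_gradient (x - y)"
proof -
  have "((\<lambda>x. x - y) has_derivative (\<lambda>h. h)) (at x)"
    by (auto intro!: derivative_eq_intros)
  then show ?thesis
    using has_derivative_compose GDERIV_sinsq[of "x - y"] unfolding gderiv_def by blast
qed

lemma torus_periodic_sinsq_shift: "torus_periodic (\<lambda>x. f (sinsq (x - y)))"
  using torus_periodic_sinsq unfolding torus_periodic_def
  by (metis add.commute add_diff_eq)

lemma sinsq_minus_commute: "sinsq (x - y) = sinsq (y - x)"
  unfolding sinsq_def
proof (rule sum.cong)
  fix i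
  have "pi * (x - y) $ i = - (pi * (y - x) $ i)" by (simp add: algebra_simps)
  then show "(sin (pi * (x - y) $ i))\<^sup>2 = (sin (pi * (y - x) $ i))\<^sup>2"
    by (metis power2_minus sin_minus)
qed auto

lemma sinsq_gradient_minus: "sinsq_gradient (x - y) = - sinsq_gradient (y - x)"
proof -
  have "pi * (x - y) $ i = - (pi * (y - x) $ i)" for i by (simp add: algebra_simps)
  then show ?thesis unfolding sinsq_gradient_def vec_eq_iff by simp
qed

lemma continuous_on_extend_past_joint:
  assumes "continuous_on (UNIV \<times> {0..}) (\<lambda>(x, t). u x t)" and "continuous_on S f" and "continuous_on S h"
  shows "continuous_on S (\<lambda>z. extend_past (u (f z)) (h z))"
proof -
  have "continuous_on S (\<lambda>z. (\<lambda>(x, t). u x t) (f z, max (h z) 0))"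
    using assms(2,3) by (intro continuous_on_compose2[OF assms(1)] continuous_intros) auto
  then show ?thesis by (simp add: extend_past_eq)
qed

lemma continuous_on_time_slice:
  assumes "continuous_on (UNIV \<times> {0..}) (\<lambda>(x, t). u x t)"
  shows "continuous_on {0..} (u x)"
proof -
  have "continuous_on {0..} (\<lambda>t. (\<lambda>(x, t). u x t) (x, t))"
    by (intro continuous_on_compose2[OF assms] continuous_intros) auto
  then show ?thesis by simp
qed

section \<open>Growth away from the initial datum\<close>

text \<open>If \<open>u\<close> minus the barrier had its maximum at a positive time, the equation
  there would contradict the choice of the constant. The maximum therefore sits at the initial
  datum, where the Lipschitz bound decides.\<close>

lemma subsolution_initial_growth:
  fixes u :: "real ^ 'n \<Rightarrow> real \<Rightarrow> real"
  assumes \<alpha>: "0 < \<alpha>" "\<alpha> < 1" and sub: "viscosity_subsolution \<alpha> H u"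
    and per: "\<And>t. 0 \<le> t \<Longrightarrow> torus_periodic (\<lambda>x. u x t)"
    and cont: "continuous_on (UNIV \<times> {0..}) (\<lambda>(x, t). u x t)"
    and bnd: "\<And>x t. 0 \<le> t \<Longrightarrow> \<bar>u x t\<bar> \<le> M"
    and K: "0 \<le> K" "\<And>x y. u x 0 - u y 0 \<le> K * torus_dist x y"
    and B: "0 \<le> B" "\<And>x p. norm p \<le> K * pi \<Longrightarrow> - B \<le> H x p"
    and "0 \<le> t"
  shows "u x t \<le> u x 0 + (\<alpha> * B + 1) * t powr \<alpha>"
proof -
  \<comment> \<open>This choice gives \<open>C / \<alpha> - B = 1 / \<alpha>\<close>, a strict
    margin over the lowest value of the Hamiltonian.\<close>
  define C where "C = \<alpha> * B + 1"
  have C: "0 < C" using \<alpha> B by (simp add: C_def add_nonneg_pos)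
  have claim: "u x t \<le> u x 0 + K * \<epsilon> + C * t powr \<alpha>" if \<epsilon>: "0 < \<epsilon>" for \<epsilon>
  proof -
    \<comment> \<open>A smoothed cone: it lies above \<open>K * torus_dist z x\<close>, has slope at
      most \<open>K * pi\<close>, and costs only \<open>K * \<epsilon>\<close> at its tip.\<close>
    define a where "a = (\<lambda>z. K * sqrt (\<epsilon>\<^sup>2 + sinsq (z - x)))"
    define a' where "a' = (\<lambda>z. (K * (inverse (sqrt (\<epsilon>\<^sup>2 + sinsq (z - x))) / 2)) *\<^sub>R sinsq_gradient (z - x))"
    have pos: "0 < \<epsilon>\<^sup>2 + sinsq z" for z :: "real ^ 'n"
      using \<epsilon> sinsq_nonneg[of z] by (simp add: add_pos_nonneg)
    have a_per: "torus_periodic a"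
      unfolding a_def by (rule torus_periodic_sinsq_shift)
    have a_deriv: "GDERIV a z :> a' z" for z
      unfolding a_def a'_def
      by (rule GDERIV_DERIV_compose[OF GDERIV_sinsq_shift, of "\<lambda>v. K * sqrt (\<epsilon>\<^sup>2 + v)"])
         (use pos[of "z - x"] in \<open>auto intro!: derivative_eq_intros\<close>)
    have a_cont: "continuous_on UNIV a"
      unfolding a_def by (intro continuous_intros)
    have a'_cont: "continuous_on UNIV a'"
      unfolding a'_def using pos by (intro continuous_intros) (auto simp: less_imp_neq[symmetric])
    have a'_norm: "norm (a' z) \<le> K * pi" for z
    proof -
      have "norm (a' z) \<le> (K * (inverse (sqrt (\<epsilon>\<^sup>2 + sinsq (z - x))) / 2)) * (2 * pi * sqrt (\<epsilon>\<^sup>2 + sinsq (z - x)))"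
        unfolding a'_def norm_scaleR using K pos[of "z - x"]
        by (intro mult_mono order_trans[OF norm_sinsq_gradient]) (auto simp: sinsq_nonneg)
      also have "\<dots> = K * pi" using pos[of "z - x"] by (simp add: less_imp_neq[symmetric])
      finally show ?thesis .
    qed
    have a_ge: "u z 0 - a z \<le> u x 0" for z
    proof -
      have "torus_dist z x \<le> sqrt (\<epsilon>\<^sup>2 + sinsq (z - x))"
        by (rule order_trans[OF torus_dist_le_sqrt_sinsq]) simp
      then have "K * torus_dist z x \<le> a z" unfolding a_def using K by (intro mult_left_mono) auto
      then show ?thesis using K(2)[of z x] by simp
    qed
    define F where "F = (\<lambda>(z, t). extend_past (u z) t - a z - C * (max t 0) powr \<alpha>)"
    obtain x0 t0 where max: "\<And>z t. F (z, t) \<le> F (x0, t0)"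
    proof -
      \<comment> \<open>Beyond this time the term \<open>C * t powr \<alpha>\<close> pushes
        \<open>F\<close> below its value at \<open>(x, 0)\<close>.\<close>
      define T where "T = ((M - F (x, 0)) / C) powr (1 / \<alpha>)"
      have "continuous_on UNIV F"
        unfolding F_def case_prod_unfold
        by (intro continuous_intros continuous_on_extend_past_joint[OF cont]
            continuous_on_compose2[OF a_cont] continuous_on_pos_part_powr \<alpha>) auto
      moreover have "compact (cbox (0 :: real ^ 'n) 1 \<times> {0..T})"
        by (intro compact_Times) auto
      moreover have "F w \<le> F (x, 0) \<or> (\<exists>w'\<in>cbox 0 1 \<times> {0..T}. F w \<le> F w')" for w
      proof (cases "F w \<le> F (x, 0)")
        case False
        obtain z t where w: "w = (z, t)" by (cases w)
        have "0 \<le> a z" using K pos[of "z - x"] by (simp add: a_def)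
        then have "F w \<le> M - C * (max t 0) powr \<alpha>"
          using bnd[of "max t 0" z] by (simp add: F_def w extend_past_eq)
        then have "(max t 0) powr \<alpha> \<le> (M - F (x, 0)) / C"
          using False C by (simp add: field_simps)
        then have "((max t 0) powr \<alpha>) powr (1 / \<alpha>) \<le> T"
          unfolding T_def using \<alpha> by (intro powr_mono2) auto
        then have T: "max t 0 \<in> {0..T}"
          using \<alpha> by (simp add: powr_powr)
        have "torus_periodic (\<lambda>z. F (z, max t 0))"
          using per[of "max t 0"] a_per by (simp add: torus_periodic_def F_def extend_past_eq)
        from torus_periodic_representative[OF this, of z]
        obtain z' where "z' \<in> cbox 0 1" "F (z', max t 0) = F (z, max t 0)" .
        moreover have "F (z, max t 0) = F w" by (simp add: F_def w extend_past_eq)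
        ultimately show ?thesis using T by (metis SigmaI order_refl)
      qed simp
      ultimately obtain w where "\<And>w'. F w' \<le> F w" using attains_global_max by blast
      then show ?thesis using that by (metis surj_pair)
    qed
    have "F (x0, t0) \<le> u x 0"
    proof (cases "0 < t0")
      case False
      then show ?thesis using a_ge[of x0] by (simp add: F_def extend_past_eq max_def)
    next
      case True
      have b: "((\<lambda>t. C * t powr \<alpha>) has_real_derivative C * (\<alpha> * t powr (\<alpha> - 1))) (at t)" if "0 < t" for t
        using that by (auto intro!: derivative_eq_intros)
      have b': "continuous_on {0<..} (\<lambda>t. C * (\<alpha> * t powr (\<alpha> - 1)))"
        by (intro continuous_intros) auto
      have "u z t - a z - C * t powr \<alpha> \<le> u x0 t0 - a x0 - C * t0 powr \<alpha>" if "0 < t" for z t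
        using max[of z t] that True by (simp add: F_def extend_past_eq)
      \<comment> \<open>The error \<open>1 / (2 * \<alpha>)\<close> is half of the available
        margin.\<close>
      from viscosity_subsolution_touching[OF \<alpha> sub a_per a_deriv a'_cont b b' True this, of "1 / (2 * \<alpha>)"] \<alpha>
      obtain d0 where "0 < d0" and d0: "\<And>d. 0 < d \<Longrightarrow> d < d0 \<Longrightarrow>
          caputo_tail \<alpha> (t0 - d) (u x0) t0 + H x0 (a' x0) \<le> 1 / (2 * \<alpha>)" by auto
      define d where "d = min d0 t0 / 2"
      have d: "0 < d" "d < d0" "d < t0" using \<open>0 < d0\<close> True by (auto simp: d_def)
      \<comment> \<open>The second function in the comparison of tails is taken to be zero, so the
        lemma bounds a single tail.\<close>
      have incr: "C * (t0 powr \<alpha> - (max (t0 - r) 0) powr \<alpha>)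
          \<le> 1 * (extend_past (u x0) t0 - extend_past (u x0) (t0 - r))
            - (extend_past (\<lambda>_. 0) 0 - extend_past (\<lambda>_. 0) (0 - r))" for r
        using max[of x0 "t0 - r"] True by (simp add: F_def extend_past_eq algebra_simps)
      have "0 \<le> M" using bnd[of 0 x] by simp
      then have "C / \<alpha> \<le> 1 * caputo_tail \<alpha> (t0 - d) (u x0) t0 - caputo_tail \<alpha> (0 - d) (\<lambda>_. 0) 0"
        using C d bnd incr
        by (intro caputo_tail_difference_ge[where M = M] \<alpha> continuous_on_time_slice[OF cont]) auto
      also have "caputo_tail \<alpha> (0 - d) (\<lambda>_. 0) 0 = 0"
        by (simp add: caputo_tail_def extend_past_def)
      finally have "C / \<alpha> - B \<le> 1 / (2 * \<alpha>)"
        using d0[OF d(1,2)] B(2)[OF a'_norm, of x0 x0] by simp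
      moreover have "C / \<alpha> - B = 1 / \<alpha>" using \<alpha> by (simp add: C_def field_simps)
      ultimately show ?thesis using \<alpha> by (simp add: field_simps)
    qed
    then have "F (x, t) \<le> u x 0" using max[of x t] by simp
    then show ?thesis using \<epsilon> \<open>0 \<le> t\<close> by (simp add: F_def extend_past_eq a_def sinsq_0)
  qed
  have "u x t \<le> u x 0 + C * t powr \<alpha> + e" if "0 < e" for e
  proof -
    have "K * (e / (K + 1)) \<le> e" using K that by (simp add: field_simps)
    then show ?thesis using claim[of "e / (K + 1)"] K that by simp
  qed
  then show ?thesis unfolding C_def by (rule field_le_epsilon)
qed

section \<open>Existence and concentration of doubled maxima\<close>

text \<open>Otherwise each doubling of \<open>k\<close> would lower the maximal value by at least
  \<open>r / 2\<close>, although it always stays above \<open>F z1\<close>.\<close>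

lemma penalty_vanishes:
  fixes F Q :: "'a \<Rightarrow> real"
  assumes ex: "\<forall>k\<ge>1. \<exists>z. \<forall>z'. F z' - k * Q z' \<le> F z - k * Q z"
    and "Q z1 = 0" and "0 < r"
  obtains k z where "1 \<le> k" and "\<forall>z'. F z' - k * Q z' \<le> F z - k * Q z" and "k * Q z < r"
proof (rule ccontr)
  assume not: "\<not> thesis"
  have large: "r \<le> k * Q z" if max: "1 \<le> k" "\<forall>z'. F z' - k * Q z' \<le> F z - k * Q z" for k z
    using not \<open>\<And>k z. \<lbrakk>1 \<le> k; \<forall>z'. F z' - k * Q z' \<le> F z - k * Q z; k * Q z < r\<rbrakk> \<Longrightarrow> thesis\<close>[OF max]
    by (meson not_le)
  have "\<forall>j. \<exists>z. \<forall>z'. F z' - 2 ^ j * Q z' \<le> F z - 2 ^ j * Q z"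
    using ex by simp
  then obtain z where z: "\<And>j. \<forall>z'. F z' - 2 ^ j * Q z' \<le> F (z j) - 2 ^ j * Q (z j)"
    by metis
  define m where "m = (\<lambda>j. F (z j) - 2 ^ j * Q (z j))"
  \<comment> \<open>The maximum for \<open>2 ^ j\<close> is compared with the maximiser for
    \<open>2 ^ Suc j\<close>; there the two functionals differ by half of the larger
    penalty.\<close>
  have step: "m (Suc j) \<le> m j - r / 2" for j
    using spec[OF z[of j], of "z (Suc j)"] large[OF _ z, of "Suc j"] one_le_power[of "2 :: real" "Suc j"]
    by (simp add: m_def)
  have "m j \<le> m 0 - j * (r / 2)" for j
  proof (induction j)
    case (Suc j)
    then show ?case using step[of j] by (simp add: field_simps)
  qed simp
  moreover have "F z1 \<le> m j" for j
    using spec[OF z[of j], of z1] assms(2) by (simp add: m_def)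
  moreover obtain j :: nat where "(m 0 - F z1) / (r / 2) < j" using reals_Archimedean2 by blast
  ultimately show False using assms(3) by (smt (verit) divide_less_eq half_gt_zero)
qed

text \<open>At a pair above the reference level, \<open>\<beta>\<close> bounds \<open>\<tau>\<close>
  from above and the penalty bounds \<open>\<tau> - h - s\<close>. What remains is brought into a
  compact set by a common forward shift of negative times and by lattice translations.\<close>

lemma doubling_max_exists:
  fixes u :: "real ^ 'n \<Rightarrow> real \<Rightarrow> real" and h :: real
  assumes \<alpha>: "0 < \<alpha>"
    and per: "\<And>t. 0 \<le> t \<Longrightarrow> torus_periodic (\<lambda>x. u x t)"
    and cont: "continuous_on (UNIV \<times> {0..}) (\<lambda>(x, t). u x t)"
    and bnd: "\<And>x t. 0 \<le> t \<Longrightarrow> \<bar>u x t\<bar> \<le> M"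
    and \<mu>: "0 < \<mu>" "\<mu> \<le> 1" and \<beta>: "0 < \<beta>" and k: "1 \<le> k"
  defines "\<Phi> \<equiv> \<lambda>((x, \<tau>), (y, s)). \<mu> * extend_past (u x) \<tau> - extend_past (u y) s
      - \<beta> * (max \<tau> 0) powr \<alpha> - k * (sinsq (x - y) + (\<tau> - h - s)\<^sup>2)"
  shows "\<exists>z. \<forall>z'. \<Phi> z' \<le> \<Phi> z"
proof -
  \<comment> \<open>The reference level is taken at a pair where the penalty is zero.\<close>
  define c where "c = \<Phi> ((0, h), (0, 0))"
  define T where "T = ((2 * M - c) / \<beta>) powr (1 / \<alpha>)"
  \<comment> \<open>The added 1 ensures \<open>2 * M - c \<le> \<rho>\<^sup>2\<close> even when
    \<open>2 * M - c\<close> is small.\<close>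
  define \<rho> where "\<rho> = 2 * M - c + 1"
  define R where "R = T + \<rho> + \<bar>h\<bar>"
  let ?K = "(cbox (0 :: real ^ 'n) 1 \<times> {-R..R}) \<times> (cbox (0 :: real ^ 'n) 1 \<times> {-R..R})"
  have "compact ?K" by (intro compact_Times) auto
  moreover have "continuous_on UNIV \<Phi>"
    unfolding \<Phi>_def case_prod_unfold
    by (intro continuous_intros continuous_on_extend_past_joint[OF cont] continuous_on_pos_part_powr \<alpha>)
  moreover have "\<Phi> w \<le> \<Phi> ((0, h), (0, 0)) \<or> (\<exists>w'\<in>?K. \<Phi> w \<le> \<Phi> w')" for w
  proof (cases "\<Phi> w \<le> c")
    case False
    obtain x \<tau> y s where w: "w = ((x, \<tau>), (y, s))" by (metis surj_pair)
    let ?q = "(\<tau> - h - s)\<^sup>2"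
    have "0 \<le> M" using bnd[of 0 x] by simp
    have "\<bar>\<mu> * extend_past (u x) \<tau>\<bar> \<le> 1 * M"
      unfolding abs_mult extend_past_eq using \<mu> bnd[of "max \<tau> 0" x] by (intro mult_mono) auto
    moreover have "\<bar>extend_past (u y) s\<bar> \<le> M" using bnd[of "max s 0" y] by (simp add: extend_past_eq)
    ultimately have "\<beta> * (max \<tau> 0) powr \<alpha> + k * (sinsq (x - y) + ?q) < 2 * M - c"
      using False by (simp add: \<Phi>_def w)
    moreover have "?q \<le> k * (sinsq (x - y) + ?q)"
      using k sinsq_nonneg[of "x - y"] mult_mono[of 1 k ?q "sinsq (x - y) + ?q"] by simp
    moreover have "0 \<le> \<beta> * (max \<tau> 0) powr \<alpha>" using \<beta> by simp
    ultimately have q: "?q < 2 * M - c" and "\<beta> * (max \<tau> 0) powr \<alpha> < 2 * M - c"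
      using zero_le_power2[of "\<tau> - h - s"] by linarith+
    then have "(max \<tau> 0) powr \<alpha> \<le> (2 * M - c) / \<beta>"
      using \<beta> by (simp add: field_simps)
    then have "((max \<tau> 0) powr \<alpha>) powr (1 / \<alpha>) \<le> T"
      unfolding T_def using \<alpha> by (intro powr_mono2) auto
    then have T: "max \<tau> 0 \<le> T" using \<alpha> by (simp add: powr_powr)
    have \<rho>: "\<bar>\<tau> - h - s\<bar> \<le> \<rho>"
    proof (rule power2_le_imp_le)
      have "0 < 2 * M - c" using q zero_le_power2[of "\<tau> - h - s"] by linarith
      moreover have "e \<le> (e + 1)\<^sup>2" if "0 < e" for e :: real
        using that zero_le_power2[of e] unfolding power2_sum by simp
      ultimately have "2 * M - c \<le> \<rho>\<^sup>2" unfolding \<rho>_def by blast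
      then show "\<bar>\<tau> - h - s\<bar>\<^sup>2 \<le> \<rho>\<^sup>2" using q by simp
      show "0 \<le> \<rho>" using \<open>0 < 2 * M - c\<close> by (simp add: \<rho>_def)
    qed
    \<comment> \<open>Before time 0 the extended solution is constant in time, so a pair of negative times
      may be translated forward together until the later one reaches 0.\<close>
    define \<theta> where "\<theta> = min (max \<tau> s) 0"
    have max_eq: "max (\<tau> - \<theta>) 0 = max \<tau> 0" "max (s - \<theta>) 0 = max s 0" by (auto simp: \<theta>_def)
    have range: "\<tau> - \<theta> \<in> {-R..R}" "s - \<theta> \<in> {-R..R}"
      using T \<rho> by (auto simp: \<theta>_def R_def)
    obtain i where i: "i \<in> int_lattice" "x + i \<in> cbox 0 1" by (rule torus_representative)
    obtain j where j: "j \<in> int_lattice" "y + j \<in> cbox 0 1" by (rule torus_representative)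
    have "sinsq (x + i - (y + j)) = sinsq (x - (y + j))"
      using torus_periodic_sinsq_shift[of "\<lambda>v. v" "y + j"] i by (simp add: torus_periodic_def)
    also have "\<dots> = sinsq (y + j - x)" by (rule sinsq_minus_commute)
    also have "\<dots> = sinsq (y - x)"
      using torus_periodic_sinsq_shift[of "\<lambda>v. v" x] j by (simp add: torus_periodic_def)
    also have "\<dots> = sinsq (x - y)" by (rule sinsq_minus_commute)
    finally have sinsq_eq: "sinsq (x + i - (y + j)) = sinsq (x - y)" .
    have "\<Phi> ((x + i, \<tau> - \<theta>), (y + j, s - \<theta>)) = \<Phi> w"
      using per[of "max \<tau> 0"] per[of "max s 0"] i j
      by (simp add: \<Phi>_def w extend_past_eq max_eq sinsq_eq torus_periodic_def add_diff_eq)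
    then show ?thesis using range i j by (intro disjI2 bexI[of _ "((x + i, \<tau> - \<theta>), (y + j, s - \<theta>))"]) auto
  qed (simp add: c_def)
  ultimately show ?thesis using attains_global_max[of ?K \<Phi>] by blast
qed

text \<open>Under condition (B) the price \<open>(1 - \<mu>) * A\<close> of scaling the gradient vanishes as \<open>\<mu>\<close> tends to 1,
  while its gain \<open>(1 - \<mu>) * norm p powr m / c\<close> absorbs the oscillation of \<open>H\<close> in \<open>x\<close>.\<close>

lemma scaled_hamiltonian_lower_bound:
  fixes H :: "real ^ 'n \<Rightarrow> real ^ 'n \<Rightarrow> real"
  assumes "condition_A H \<or> condition_B H" and \<eta>: "0 < \<eta>"
  obtains \<mu> r where "0 < \<mu>" "\<mu> \<le> 1" "1 - \<mu> \<le> \<eta>" "0 < r"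
    and "\<And>x y p. torus_dist x y < r \<Longrightarrow> norm p * torus_dist x y < r \<Longrightarrow>
           - \<eta> \<le> \<mu> * H x (inverse \<mu> *\<^sub>R p) - H y p"
proof (cases "condition_A H")
  case True
  then obtain c where c: "0 < c" "\<And>x y p. \<bar>H x p - H y p\<bar> \<le> c * (1 + norm p) * torus_dist x y"
    unfolding condition_A_def by auto
  show ?thesis
  \<comment> \<open>Under (A) no scaling takes place: the linear growth in \<open>p\<close> is
    controlled by the smallness of \<open>norm p * torus_dist x y\<close>.\<close>
  proof (rule that[of 1 "\<eta> / (2 * c)"])
    fix x y p :: "real ^ 'n" assume "torus_dist x y < \<eta> / (2 * c)" "norm p * torus_dist x y < \<eta> / (2 * c)"
    then have "c * torus_dist x y + c * (norm p * torus_dist x y) \<le> \<eta>"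
      using c(1) by (simp add: field_simps)
    then show "- \<eta> \<le> 1 * H x (inverse 1 *\<^sub>R p) - H y p"
      using c(2)[of x p y] by (simp add: algebra_simps)
  qed (use \<eta> c in auto)
next
  case False
  then obtain m A c where "0 < A" "1 < c"
    and B1: "\<And>\<mu> x p. \<mu> \<in> {0<..<1} \<Longrightarrow>
      (1 - \<mu>) * (inverse c * norm p powr m - A) \<le> \<mu> * H x (inverse \<mu> *\<^sub>R p) - H x p"
    and B2': "\<And>\<mu> x y p. \<mu> \<in> {0<..<1::real} \<Longrightarrow> \<bar>H x p - H y p\<bar> \<le> c * (1 + norm p powr m) * torus_dist x y"
    using assms(1) unfolding condition_B_def by blast
  \<comment> \<open>This clause does not mention \<open>\<mu>\<close>, so any admissible value, here
    1/2, yields it.\<close>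
  have B2: "\<bar>H x p - H y p\<bar> \<le> c * (1 + norm p powr m) * torus_dist x y" for x y p
    using B2'[of "1 / 2"] by simp
  define \<kappa> where "\<kappa> = min (1 / 2) (min \<eta> (\<eta> / (2 * A)))"
  have \<kappa>: "0 < \<kappa>" "\<kappa> < 1" "\<kappa> \<le> \<eta>" "\<kappa> \<le> \<eta> / (2 * A)"
    using \<eta> \<open>0 < A\<close> by (auto simp: \<kappa>_def)
  then have \<kappa>A: "\<kappa> * A \<le> \<eta> / 2" using \<open>0 < A\<close> by (simp add: field_simps)
  show ?thesis
  \<comment> \<open>The first radius makes the oscillating term in \<open>norm p powr m\<close> at
    most the gain \<open>\<kappa> * inverse c * norm p powr m\<close>; the second leaves
    \<open>\<eta> / 2\<close> for the constant term, the other half paying for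
    \<open>\<kappa> * A\<close>.\<close>
  proof (rule that[of "1 - \<kappa>" "min (\<kappa> / c\<^sup>2) (\<eta> / (2 * c))"])
    fix x y p :: "real ^ 'n" assume "torus_dist x y < min (\<kappa> / c\<^sup>2) (\<eta> / (2 * c))"
    then have d: "c * torus_dist x y \<le> \<kappa> * inverse c" "c * torus_dist x y \<le> \<eta> / 2"
      using \<open>1 < c\<close> by (auto simp: field_simps power2_eq_square)
    have "(c * torus_dist x y) * norm p powr m \<le> (\<kappa> * inverse c) * norm p powr m"
      using d(1) by (intro mult_right_mono) auto
    moreover have "\<kappa> * (inverse c * norm p powr m - A) \<le> (1 - \<kappa>) * H x (inverse (1 - \<kappa>) *\<^sub>R p) - H x p"
      using B1[of "1 - \<kappa>" p x] \<kappa> by simp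
    moreover have "H y p - H x p \<le> c * torus_dist x y + (c * torus_dist x y) * norm p powr m"
      using B2[of x p y] by (simp add: algebra_simps)
    ultimately show "- \<eta> \<le> (1 - \<kappa>) * H x (inverse (1 - \<kappa>) *\<^sub>R p) - H y p"
      using d(2) \<kappa>A by (simp add: algebra_simps)
  qed (use \<eta> \<kappa> \<open>1 < c\<close> in auto)
qed

section \<open>Propagation of the initial bound to all times\<close>

text \<open>A violation survives as a positive gap at a maximum of the doubled functional with both
  times positive. Subtracting the two viscosity inequalities there sets the memory gain
  \<open>\<beta> / \<alpha>\<close> against three errors of at most
  \<open>\<beta> / (4 * \<alpha>)\<close>. The shift \<open>h\<close> may have either sign.\<close>

lemma solution_increment_bound:
  fixes u :: "real ^ 'n \<Rightarrow> real \<Rightarrow> real" and h :: real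
  assumes \<alpha>: "0 < \<alpha>" "\<alpha> < 1" and H: "condition_A H \<or> condition_B H"
    and sub: "viscosity_subsolution \<alpha> H u" and super: "viscosity_supersolution \<alpha> H u"
    and per: "\<And>t. 0 \<le> t \<Longrightarrow> torus_periodic (\<lambda>x. u x t)"
    and cont: "continuous_on (UNIV \<times> {0..}) (\<lambda>(x, t). u x t)"
    and bnd: "\<And>x t. 0 \<le> t \<Longrightarrow> \<bar>u x t\<bar> \<le> M"
    and K: "0 \<le> K" "\<And>x y. u x 0 - u y 0 \<le> K * torus_dist x y"
    and C: "0 \<le> C" "\<And>x t. 0 \<le> t \<Longrightarrow> \<bar>u x t - u x 0\<bar> \<le> C * t powr \<alpha>"
  shows "extend_past (u x1) (t1 + h) - extend_past (u x1) t1 \<le> C * \<bar>h\<bar> powr \<alpha>"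
proof -
  define U where "U = (\<lambda>x. extend_past (u x))"
  have U_pos: "U x t = u x t" if "0 < t" for x t using that by (simp add: U_def extend_past_eq)
  have U_bnd: "\<bar>U x t\<bar> \<le> M" for x t using bnd[of "max t 0" x] by (simp add: U_def extend_past_eq)
  have U_0: "\<bar>U x t - u x 0\<bar> \<le> C * (max t 0) powr \<alpha>" for x t
    using C(2)[of "max t 0" x] by (simp add: U_def extend_past_eq)
  have "0 \<le> M" using bnd[of 0 x1] by simp
  have main: "U x1 (t1 + h) - U x1 t1 \<le> C * \<bar>h\<bar> powr \<alpha> + \<beta> * (max (t1 + h) 0) powr \<alpha>"
    if \<beta>: "0 < \<beta>" for \<beta>
  proof (rule ccontr)
    \<comment> \<open>The excess is split in three: two parts pay for replacing \<open>U\<close> by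
      \<open>\<mu> * U\<close>, once in \<open>gap\<close> and once in \<open>upper\<close>, and the
      third for the mismatch \<open>K * \<omega> + C * \<omega> powr \<alpha>\<close>.\<close>
    define \<Delta> where "\<Delta> = (U x1 (t1 + h) - U x1 t1 - C * \<bar>h\<bar> powr \<alpha> - \<beta> * (max (t1 + h) 0) powr \<alpha>) / 3"
    assume "\<not> ?thesis"
    then have \<Delta>: "0 < \<Delta>" by (simp add: \<Delta>_def)
    \<comment> \<open>The first entry limits the Hamiltonian error, the second the cost
      \<open>(1 - \<mu>) * M\<close> of scaling.\<close>
    define \<eta> where "\<eta> = min (\<beta> / (4 * \<alpha>)) (\<Delta> / (M + 1))"
    have \<eta>: "0 < \<eta>" using \<beta> \<alpha> \<Delta> \<open>0 \<le> M\<close> by (simp add: \<eta>_def)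
    have "\<eta> * M \<le> \<Delta> / (M + 1) * M" using \<open>0 \<le> M\<close> by (intro mult_right_mono) (auto simp: \<eta>_def)
    also have "\<dots> \<le> \<Delta>" using \<Delta> \<open>0 \<le> M\<close> by (simp add: field_simps)
    finally have \<eta>M: "\<eta> * M \<le> \<Delta>" .
    obtain \<mu> r where \<mu>: "0 < \<mu>" "\<mu> \<le> 1" "1 - \<mu> \<le> \<eta>" and r: "0 < r"
      and Hr: "\<And>x y p. torus_dist x y < r \<Longrightarrow> norm p * torus_dist x y < r \<Longrightarrow>
           - \<eta> \<le> \<mu> * H x (inverse \<mu> *\<^sub>R p) - H y p"
      using scaled_hamiltonian_lower_bound[OF H \<eta>] by blast
    have \<mu>U: "\<bar>\<mu> * U x t - U x t\<bar> \<le> \<Delta>" for x t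
    proof -
      have "\<bar>\<mu> * U x t - U x t\<bar> = (1 - \<mu>) * \<bar>U x t\<bar>"
        using \<mu>(2) by (simp add: abs_mult flip: left_diff_distrib[of \<mu> 1, simplified])
      also have "\<dots> \<le> \<eta> * M" using \<mu> U_bnd[of x t] \<eta> by (intro mult_mono) auto
      finally show ?thesis using \<eta>M by simp
    qed
    obtain \<omega> where \<omega>: "0 < \<omega>" "K * \<omega> + C * \<omega> powr \<alpha> < \<Delta>"
    proof -
      have "((\<lambda>w. K * w + C * w powr \<alpha>) \<longlongrightarrow> K * 0 + C * 0 powr \<alpha>) (at_right 0)"
        using \<alpha> by (intro tendsto_intros) (auto simp: eventually_at_filter)
      then have "\<forall>\<^sub>F w in at_right 0. K * w + C * w powr \<alpha> < \<Delta>"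
        using \<Delta> by (intro order_tendstoD(2)) auto
      then obtain w0 where "0 < w0" "\<And>w. 0 < w \<Longrightarrow> w < w0 \<Longrightarrow> K * w + C * w powr \<alpha> < \<Delta>"
        by (auto simp: eventually_at_right_field)
      from this(1) this(2)[of "w0 / 2"] show ?thesis by (intro that[of "w0 / 2"]) auto
    qed
    \<comment> \<open>In order, the entries make the distance less than \<open>r\<close>, the
      product of gradient and distance less than \<open>r\<close>, and both the distance and the
      time mismatch less than \<open>\<omega>\<close>.\<close>
    define r' where "r' = min (min (r\<^sup>2) (r / (2 * pi))) (\<omega>\<^sup>2)"
    have r': "0 < r'" using r \<omega> by (simp add: r'_def)
    define F where "F = (\<lambda>((x, \<tau>), (y, s)). \<mu> * U x \<tau> - U y s - \<beta> * (max \<tau> 0) powr \<alpha>)"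
    define Q :: "((real ^ 'n) \<times> real) \<times> ((real ^ 'n) \<times> real) \<Rightarrow> real"
      where "Q = (\<lambda>((x, \<tau>), (y, s)). sinsq (x - y) + (\<tau> - h - s)\<^sup>2)"
    have ex: "\<forall>k\<ge>1. \<exists>z. \<forall>z'. F z' - k * Q z' \<le> F z - k * Q z"
      using doubling_max_exists[OF \<alpha>(1) per cont bnd \<mu>(1,2) \<beta>, where h = h]
      by (simp add: F_def Q_def U_def case_prod_unfold)
    have Q0: "Q ((x1, t1 + h), (x1, t1)) = 0" by (simp add: Q_def sinsq_0)
    obtain k z where k: "1 \<le> k" and max: "\<forall>z'. F z' - k * Q z' \<le> F z - k * Q z"
      and small: "k * Q z < r'"
      by (rule penalty_vanishes[OF ex Q0 r'])
    obtain x \<tau> y s where z: "z = ((x, \<tau>), (y, s))" by (metis surj_pair)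
    define S where "S = sinsq (x - y)"
    define \<rho> where "\<rho> = \<tau> - h - s"
    define p where "p = k *\<^sub>R sinsq_gradient (x - y)"
    have "0 \<le> S" by (simp add: S_def sinsq_nonneg)
    have "k * S + k * \<rho>\<^sup>2 < r'" using small by (simp add: z Q_def S_def \<rho>_def distrib_left)
    moreover have "S \<le> k * S" "\<rho>\<^sup>2 \<le> k * \<rho>\<^sup>2" "0 \<le> k * \<rho>\<^sup>2"
      using k \<open>0 \<le> S\<close> mult_right_mono[of 1 k S] mult_right_mono[of 1 k "\<rho>\<^sup>2"] by auto
    ultimately have kS: "k * S < r'" and S: "S < r'" and \<rho>2: "\<rho>\<^sup>2 < r'"
      using \<open>0 \<le> S\<close> zero_le_power2[of \<rho>] by linarith+
    have dist_le: "torus_dist x y \<le> sqrt S" unfolding S_def by (rule torus_dist_le_sqrt_sinsq)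
    have "sqrt S < r" "sqrt S < \<omega>"
      using S r \<omega>(1) by (auto simp: r'_def intro!: real_less_lsqrt)
    then have dist: "torus_dist x y < r" "torus_dist x y < \<omega>" using dist_le by auto
    have \<rho>: "\<bar>\<rho>\<bar> < \<omega>"
      using \<rho>2 \<omega>(1) by (auto simp: r'_def intro: power2_less_imp_less[of "\<bar>\<rho>\<bar>" \<omega>])
    have "norm p * torus_dist x y \<le> (k * (2 * pi * sqrt S)) * sqrt S"
      unfolding p_def S_def norm_scaleR using k norm_sinsq_gradient[of "x - y"]
      by (intro mult_mono torus_dist_le_sqrt_sinsq) (auto simp: sinsq_nonneg torus_dist_nonneg)
    also have "\<dots> = 2 * pi * (k * S)" using \<open>0 \<le> S\<close> by simp
    also have "\<dots> < 2 * pi * (r / (2 * pi))"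
      using kS by (intro mult_strict_left_mono) (auto simp: r'_def)
    finally have p: "norm p * torus_dist x y < r" by simp
    have gap: "C * \<bar>h\<bar> powr \<alpha> + 2 * \<Delta> \<le> \<mu> * U x \<tau> - U y s"
    proof -
      have "3 * \<Delta> = U x1 (t1 + h) - U x1 t1 - C * \<bar>h\<bar> powr \<alpha> - \<beta> * (max (t1 + h) 0) powr \<alpha>"
        by (simp add: \<Delta>_def)
      then have "C * \<bar>h\<bar> powr \<alpha> + 2 * \<Delta> \<le> F ((x1, t1 + h), (x1, t1)) - k * Q ((x1, t1 + h), (x1, t1))"
        using \<mu>U[of x1 "t1 + h"] by (simp add: F_def Q_def sinsq_0)
      also have "\<dots> \<le> F z - k * Q z" using max by blast
      also have "\<dots> \<le> \<mu> * U x \<tau> - U y s"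
      proof -
        have "0 \<le> k * (S + \<rho>\<^sup>2)" using k \<open>0 \<le> S\<close> by (intro mult_nonneg_nonneg) auto
        moreover have "0 \<le> \<beta> * (max \<tau> 0) powr \<alpha>" using \<beta> by simp
        ultimately show ?thesis by (simp add: z F_def Q_def S_def \<rho>_def)
      qed
      finally show ?thesis .
    qed
    have upper: "\<mu> * U x \<tau> - U y s \<le> \<Delta> + K * \<omega> + C * ((max \<tau> 0) powr \<alpha> + (max s 0) powr \<alpha>)"
    proof -
      have "K * torus_dist x y \<le> K * \<omega>" using K dist by (intro mult_left_mono) auto
      then show ?thesis
        using \<mu>U[of x \<tau>] U_0[of x \<tau>] U_0[of y s] K(2)[of x y] by (simp add: distrib_left abs_le_iff)
    qed
    \<comment> \<open>If one of the two times is not positive, the other is at most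
      \<open>\<bar>h\<bar> + \<omega>\<close>, so initial growth alone rules out the gap.\<close>
    have early: "C * w powr \<alpha> \<le> C * \<bar>h\<bar> powr \<alpha> + C * \<omega> powr \<alpha>" if "0 \<le> w" "w \<le> \<bar>h\<bar> + \<omega>" for w
    proof -
      have "w powr \<alpha> \<le> (\<bar>h\<bar> + \<omega>) powr \<alpha>" using that \<alpha> by (intro powr_mono2) auto
      also have "\<dots> \<le> \<bar>h\<bar> powr \<alpha> + \<omega> powr \<alpha>" using \<alpha> \<omega> by (intro powr_add_le) auto
      finally show ?thesis using C(1) by (simp add: mult_left_mono flip: distrib_left)
    qed
    have \<tau>: "0 < \<tau>"
    proof (rule ccontr)
      assume "\<not> 0 < \<tau>"
      then have "max \<tau> 0 = 0" "max s 0 \<le> \<bar>h\<bar> + \<omega>" using \<rho> by (auto simp: \<rho>_def)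
      then show False using gap upper early[of "max s 0"] \<omega>(2) by simp
    qed
    have s: "0 < s"
    proof (rule ccontr)
      assume "\<not> 0 < s"
      then have "max s 0 = 0" "max \<tau> 0 \<le> \<bar>h\<bar> + \<omega>" using \<rho> by (auto simp: \<rho>_def)
      then show False using gap upper early[of "max \<tau> 0"] \<omega>(2) by simp
    qed
    have max': "\<mu> * U x' \<tau>' - U y' s' - \<beta> * (max \<tau>' 0) powr \<alpha> - k * (sinsq (x' - y') + (\<tau>' - h - s')\<^sup>2)
        \<le> \<mu> * U x \<tau> - U y s - \<beta> * \<tau> powr \<alpha> - k * (sinsq (x - y) + (\<tau> - h - s)\<^sup>2)" for x' \<tau>' y' s'
      using spec[OF max, of "((x', \<tau>'), (y', s'))"] \<tau> by (simp add: z F_def Q_def)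
    have e: "0 < \<beta> / (4 * \<alpha>)" using \<alpha> \<beta> by simp
    obtain d1 where d1: "0 < d1" "\<And>d. 0 < d \<Longrightarrow> d < d1 \<Longrightarrow>
        caputo_tail \<alpha> (\<tau> - d) (u x) \<tau> + H x (inverse \<mu> *\<^sub>R p) \<le> \<beta> / (4 * \<alpha>)"
    proof -
      \<comment> \<open>With \<open>(y, s)\<close> frozen, division by \<open>\<mu>\<close> turns
        the maximum for \<open>\<mu> * u\<close> into one for \<open>u\<close>; this is how the
        gradient becomes \<open>inverse \<mu> *\<^sub>R p\<close>.\<close>
      define a where "a = (\<lambda>x'. (k / \<mu>) * sinsq (x' - y))"
      define b where "b = (\<lambda>t. (\<beta> * t powr \<alpha> + k * (t - h - s)\<^sup>2) / \<mu>)"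
      have a: "torus_periodic a" unfolding a_def by (rule torus_periodic_sinsq_shift)
      have a': "GDERIV a x' :> (k / \<mu>) *\<^sub>R sinsq_gradient (x' - y)" for x'
        unfolding a_def
        by (rule GDERIV_DERIV_compose[OF GDERIV_sinsq_shift, of "\<lambda>v. (k / \<mu>) * v"])
           (use \<mu>(1) in \<open>auto intro!: derivative_eq_intros\<close>)
      have cont_a': "continuous_on UNIV (\<lambda>x'. (k / \<mu>) *\<^sub>R sinsq_gradient (x' - y))"
        by (intro continuous_intros)
      have b': "(b has_real_derivative (\<beta> * (\<alpha> * t powr (\<alpha> - 1)) + k * (2 * (t - h - s))) / \<mu>) (at t)"
        if "0 < t" for t
        unfolding b_def using that \<mu>(1) by (auto intro!: derivative_eq_intros)
      have cont_b': "continuous_on {0<..} (\<lambda>t. (\<beta> * (\<alpha> * t powr (\<alpha> - 1)) + k * (2 * (t - h - s))) / \<mu>)"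
        using \<mu>(1) by (intro continuous_intros) auto
      have "u x' t - a x' - b t \<le> u x \<tau> - a x - b \<tau>" if "0 < t" for x' t
      proof -
        have scale: "\<mu> * (v - a w - b t) = \<mu> * v - k * sinsq (w - y) - (\<beta> * t powr \<alpha> + k * (t - h - s)\<^sup>2)"
          for v w t
          unfolding a_def b_def right_diff_distrib using \<mu>(1) by simp
        have "\<mu> * (u x' t - a x' - b t) \<le> \<mu> * (u x \<tau> - a x - b \<tau>)"
          unfolding scale using max'[of x' t y s] that \<tau> by (simp add: U_pos distrib_left)
        then show ?thesis using \<mu>(1) by simp
      qed
      from viscosity_subsolution_touching[OF \<alpha> sub a a' cont_a' b' cont_b' \<tau> this e]
      obtain d0 where "0 < d0" and "\<And>d. 0 < d \<Longrightarrow> d < d0 \<Longrightarrow>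
          caputo_tail \<alpha> (\<tau> - d) (u x) \<tau> + H x ((k / \<mu>) *\<^sub>R sinsq_gradient (x - y)) \<le> \<beta> / (4 * \<alpha>)"
        by blast
      moreover have "(k / \<mu>) *\<^sub>R sinsq_gradient (x - y) = inverse \<mu> *\<^sub>R p"
        by (simp add: p_def divide_inverse mult.commute)
      ultimately show ?thesis using that[of d0] by simp
    qed
    obtain d2 where d2: "0 < d2" "\<And>d. 0 < d \<Longrightarrow> d < d2 \<Longrightarrow>
        - caputo_tail \<alpha> (s - d) (u y) s - H y p \<le> \<beta> / (4 * \<alpha>)"
    proof -
      \<comment> \<open>With \<open>(x, \<tau>)\<close> frozen, \<open>- u\<close> is touched from
        above with gradient \<open>- p\<close>; the reflected Hamiltonian restores
        \<open>p\<close>.\<close>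
      define a where "a = (\<lambda>y'. k * sinsq (y' - x))"
      define b where "b = (\<lambda>t. k * (\<tau> - h - t)\<^sup>2)"
      have a: "torus_periodic a" unfolding a_def by (rule torus_periodic_sinsq_shift)
      have a': "GDERIV a y' :> k *\<^sub>R sinsq_gradient (y' - x)" for y'
        unfolding a_def
        by (rule GDERIV_DERIV_compose[OF GDERIV_sinsq_shift, of "\<lambda>v. k * v"])
           (auto intro!: derivative_eq_intros)
      have cont_a': "continuous_on UNIV (\<lambda>y'. k *\<^sub>R sinsq_gradient (y' - x))"
        by (intro continuous_intros)
      have b': "(b has_real_derivative k * (- 2 * (\<tau> - h - t))) (at t)" for t
        unfolding b_def by (auto intro!: derivative_eq_intros)
      have cont_b': "continuous_on {0<..} (\<lambda>t. k * (- 2 * (\<tau> - h - t)))"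
        by (intro continuous_intros)
      have "- u y' t - a y' - b t \<le> - u y s - a y - b s" if "0 < t" for y' t
        using max'[of x \<tau> y' t] that \<tau> s
        by (simp add: a_def b_def U_pos distrib_left sinsq_minus_commute[of _ x])
      from viscosity_subsolution_touching[OF \<alpha> viscosity_supersolution_uminus[OF super]
          a a' cont_a' b' cont_b' s this e]
      obtain d0 where "0 < d0" and "\<And>d. 0 < d \<Longrightarrow> d < d0 \<Longrightarrow>
          caputo_tail \<alpha> (s - d) (\<lambda>t. - u y t) s + - H y (- (k *\<^sub>R sinsq_gradient (y - x))) \<le> \<beta> / (4 * \<alpha>)"
        by blast
      moreover have "- (k *\<^sub>R sinsq_gradient (y - x)) = p"
        by (simp add: p_def sinsq_gradient_minus[of x y])
      ultimately show ?thesis using that[of d0] by (simp add: caputo_tail_uminus)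
    qed
    define d where "d = min (min d1 d2) \<tau> / 2"
    have d: "0 < d" "d < d1" "d < d2" "d < \<tau>" using d1(1) d2(1) \<tau> by (auto simp: d_def)
    \<comment> \<open>Moving both times back by the same \<open>r\<close> leaves
      \<open>\<tau> - h - s\<close> unchanged, so the penalty cancels and only the increments
      remain.\<close>
    have "\<beta> * (\<tau> powr \<alpha> - (max (\<tau> - r) 0) powr \<alpha>)
        \<le> \<mu> * (U x \<tau> - U x (\<tau> - r)) - (U y s - U y (s - r))" for r
      using max'[of x "\<tau> - r" y "s - r"] by (simp add: algebra_simps)
    then have "\<beta> / \<alpha> \<le> \<mu> * caputo_tail \<alpha> (\<tau> - d) (u x) \<tau> - caputo_tail \<alpha> (s - d) (u y) s"
      unfolding U_def using \<beta> d bnd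
      by (intro caputo_tail_difference_ge[where M = M] \<alpha> continuous_on_time_slice[OF cont]) auto
    moreover have "\<mu> * (caputo_tail \<alpha> (\<tau> - d) (u x) \<tau> + H x (inverse \<mu> *\<^sub>R p)) \<le> \<beta> / (4 * \<alpha>)"
    proof -
      have "\<mu> * (caputo_tail \<alpha> (\<tau> - d) (u x) \<tau> + H x (inverse \<mu> *\<^sub>R p)) \<le> \<mu> * (\<beta> / (4 * \<alpha>))"
        using d1(2) d \<mu>(1) by (intro mult_left_mono) auto
      also have "\<dots> \<le> \<beta> / (4 * \<alpha>)" using \<mu> e by (intro mult_left_le_one_le) auto
      finally show ?thesis .
    qed
    moreover have "- caputo_tail \<alpha> (s - d) (u y) s - H y p \<le> \<beta> / (4 * \<alpha>)"
      using d2(2) d by simp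
    moreover have "- (\<beta> / (4 * \<alpha>)) \<le> \<mu> * H x (inverse \<mu> *\<^sub>R p) - H y p"
      using Hr[OF dist(1) p] by (simp add: \<eta>_def)
    \<comment> \<open>The three errors come from the subsolution inequality, the supersolution
      inequality and the Hamiltonian comparison.\<close>
    ultimately have "\<beta> / \<alpha> \<le> 3 * (\<beta> / (4 * \<alpha>))" by (simp add: distrib_left)
    then show False using \<alpha> \<beta> by (simp add: field_simps)
  qed
  define w where "w = (max (t1 + h) 0) powr \<alpha>"
  have "U x1 (t1 + h) - U x1 t1 \<le> C * \<bar>h\<bar> powr \<alpha> + e" if "0 < e" for e
  proof -
    have "0 \<le> w" by (simp add: w_def)
    \<comment> \<open>The penalty parameter \<open>\<beta> = e / (w + 1)\<close> makes the remaining
      penalty at the given point at most \<open>e\<close>.\<close>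
    then have "0 < e / (w + 1)" "e / (w + 1) * w \<le> e" using that by (auto simp: field_simps)
    then show ?thesis using main[of "e / (w + 1)"] by (simp add: w_def)
  qed
  then show ?thesis unfolding U_def by (rule field_le_epsilon)
qed

section \<open>Uniform constants and the final estimate\<close>

text \<open>Periodicity confines \<open>x\<close> to the unit cube, which leaves a compact set of
  arguments. The bound feeds the upper and the lower barrier alike.\<close>

lemma torus_hamiltonian_bounded:
  fixes H :: "real ^ 'n \<Rightarrow> real ^ 'n \<Rightarrow> real"
  assumes "torus_hamiltonian H"
  obtains B where "0 \<le> B" and "\<And>x p. norm p \<le> R \<Longrightarrow> \<bar>H x p\<bar> \<le> B"
proof -
  have "compact ((\<lambda>(x, p). H x p) ` (cbox 0 1 \<times> cball 0 R))"
    using assms unfolding torus_hamiltonian_def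
    by (intro compact_continuous_image compact_Times) (auto intro: continuous_on_subset)
  then obtain B where B: "\<And>w. w \<in> (\<lambda>(x, p). H x p) ` (cbox 0 1 \<times> cball 0 R) \<Longrightarrow> norm w \<le> B"
    using compact_imp_bounded bounded_iff by metis
  show ?thesis
  proof (rule that[of "\<bar>B\<bar>"])
    fix x p :: "real ^ 'n" assume "norm p \<le> R"
    have "torus_periodic (\<lambda>x. H x p)" using assms by (simp add: torus_hamiltonian_def)
    from torus_periodic_representative[OF this, of x]
    obtain x' where "x' \<in> cbox 0 1" "H x' p = H x p" .
    moreover from this(1) have "H x' p \<in> (\<lambda>(x, p). H x p) ` (cbox 0 1 \<times> cball 0 R)"
      using \<open>norm p \<le> R\<close> by (intro image_eqI[of _ _ "(x', p)"]) auto
    ultimately show "\<bar>H x p\<bar> \<le> \<bar>B\<bar>" using B[of "H x' p"] by simp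
  qed simp
qed

theorem theorem2p1:
  fixes \<alpha> :: real
    and H :: "real ^ 'n \<Rightarrow> real ^ 'n \<Rightarrow> real"
    and g :: "real ^ 'n \<Rightarrow> real"
  assumes "0 < \<alpha>" and "\<alpha> < 1"
    and "torus_hamiltonian H"
    and "coercive H"
    and "torus_lipschitz g"
    and "condition_A H \<or> condition_B H"
  shows "\<forall>M. \<exists>L>1. \<forall>u.
           bounded_viscosity_solution \<alpha> H g u \<and> spacetime_sup_norm u = M \<longrightarrow>
           (\<forall>x. \<forall>s\<ge>0. \<forall>t\<ge>0. \<bar>u x s - u x t\<bar> \<le> L * \<bar>s - t\<bar> powr \<alpha>)"
proof -
  obtain K' where K': "\<And>x y. \<bar>g x - g y\<bar> \<le> K' * torus_dist x y"
    using assms(5) unfolding torus_lipschitz_def by blast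
  define K where "K = \<bar>K'\<bar>"
  have K: "0 \<le> K" "\<bar>g x - g y\<bar> \<le> K * torus_dist x y" for x y
    using order_trans[OF K' mult_right_mono[OF abs_ge_self torus_dist_nonneg]] by (auto simp: K_def)
  obtain B where B: "0 \<le> B" "\<And>x p. norm p \<le> K * pi \<Longrightarrow> \<bar>H x p\<bar> \<le> B"
    using torus_hamiltonian_bounded[OF assms(3)] by blast
  define C where "C = \<alpha> * B + 1"
  have C: "0 \<le> C" using assms(1) B by (simp add: C_def)
  \<comment> \<open>\<open>C\<close> is fixed before \<open>u\<close> is chosen; adding 2 secures a
    constant above 1.\<close>
  have "\<bar>u x s - u x t\<bar> \<le> (C + 2) * \<bar>s - t\<bar> powr \<alpha>"
    if u: "bounded_viscosity_solution \<alpha> H g u" and "0 \<le> s" "0 \<le> t" for u x s t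
  proof -
    have per: "\<And>t. 0 \<le> t \<Longrightarrow> torus_periodic (\<lambda>x. u x t)"
      and cont: "continuous_on (UNIV \<times> {0..}) (\<lambda>(x, t). u x t)"
      and sub: "viscosity_subsolution \<alpha> H u" and super: "viscosity_supersolution \<alpha> H u"
      and init: "\<And>x. u x 0 = g x"
      using u by (auto simp: bounded_viscosity_solution_def)
    obtain M where M: "\<And>x t. 0 \<le> t \<Longrightarrow> \<bar>u x t\<bar> \<le> M"
    proof -
      from u obtain M where M: "\<And>z. z \<in> UNIV \<times> {0..} \<Longrightarrow> norm (case z of (x, t) \<Rightarrow> u x t) \<le> M"
        unfolding bounded_viscosity_solution_def bounded_iff by blast
      show ?thesis
      proof (rule that)
        show "\<bar>u x t\<bar> \<le> M" if "0 \<le> t" for x t using M[of "(x, t)"] that by simp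
      qed
    qed
    have "u x t \<le> u x 0 + C * t powr \<alpha>" if "0 \<le> t" for x t
      unfolding C_def
    proof (rule subsolution_initial_growth[OF assms(1,2) sub per cont M K(1) _ B(1) _ that])
      show "u x 0 - u y 0 \<le> K * torus_dist x y" for x y
        using K(2)[of x y] by (simp add: init)
      show "- B \<le> H x p" if "norm p \<le> K * pi" for x p using B(2)[OF that, of x] by simp
    qed
    \<comment> \<open>Reflection reduces the lower bound to the upper one; the ball of gradients is
      symmetric, so the same \<open>B\<close> serves.\<close>
    moreover have "- u x t \<le> - u x 0 + C * t powr \<alpha>" if "0 \<le> t" for x t
      unfolding C_def
    proof (rule subsolution_initial_growth[OF assms(1,2) viscosity_supersolution_uminus[OF super]
          _ _ _ K(1) _ B(1) _ that])
      show "torus_periodic (\<lambda>x. - u x t)" if "0 \<le> t" for t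
        using per[OF that] by (simp add: torus_periodic_def)
      show "continuous_on (UNIV \<times> {0..}) (\<lambda>(x, t). - u x t)"
        using continuous_on_minus[OF cont] by (simp add: case_prod_unfold)
      show "\<bar>- u x t\<bar> \<le> M" if "0 \<le> t" for x t using M[OF that] by simp
      show "- u x 0 - - u y 0 \<le> K * torus_dist x y" for x y
        using K(2)[of x y] by (simp add: init)
      show "- B \<le> - H x (- p)" if "norm p \<le> K * pi" for x p using B(2)[of "- p" x] that by simp
    qed
    ultimately have growth: "\<bar>u x t - u x 0\<bar> \<le> C * t powr \<alpha>" if "0 \<le> t" for x t
      using that by (smt (verit))
    have lip: "u x 0 - u y 0 \<le> K * torus_dist x y" for x y
      using K(2)[of x y] by (simp add: init)
    note incr = solution_increment_bound[OF assms(1,2,6) sub super per cont M K(1) lip C growth]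
    \<comment> \<open>The two signs of the difference come from the shifts \<open>s - t\<close> and
      \<open>t - s\<close>.\<close>
    have "\<bar>u x s - u x t\<bar> \<le> C * \<bar>s - t\<bar> powr \<alpha>"
      using incr[of x t "s - t"] incr[of x s "t - s"] \<open>0 \<le> s\<close> \<open>0 \<le> t\<close>
      by (simp add: extend_past_def abs_minus_commute abs_le_iff)
    also have "\<dots> \<le> (C + 2) * \<bar>s - t\<bar> powr \<alpha>" by (intro mult_right_mono) auto
    finally show ?thesis .
  qed
  then show ?thesis using C by (intro allI exI[of _ "C + 2"]) auto
qed

end
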